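(* Let $n\ge 1$, let $m_1,\dots,m_n\ge 1$ be integers, and let $I\subseteq\mathbb{R}$ be a semialgebraic set. Let $K\subseteq\mathbb{R}^n$ be the closed convex hull (the closure of the convex hull) of the set $$S=\{(t^{m_1},\dots,t^{m_n}) : t\in I\}\subseteq\mathbb{R}^n .$$ Then $\operatorname{sxdeg}(K)\le\lfloor n/2\rfloor+1$.
   Context: A linear matrix inequality (LMI) of size $d$ in variables $z$ is a condition $M(z)\succeq 0$ (positive semidefinite), where $M(z)$ is a real symmetric $d\times d$ matrix whose entries are affine-linear functions of $z$. For a set $C\subseteq\mathbb{R}^n$, a lifted semidefinite representation of $C$ of size $\le d$ is a description $$C=\{x\in\mathbb{R}^n : \exists\, y\in\mathbb{R}^m \text{ with } M_1(x,y)\succeq 0,\dots,M_\ell(x,y)\succeq 0\}$$ for some finite $m,\ell$, where each $M_i(x,y)\succeq0$ is an LMI in $(x,y)$ of size at most $d$. The semidefinite extension degree $\operatorname{sxdeg}(C)$ is the smallest $d$ for which $C$ has a lifted semidefinite representation of size $\le d$ (the number $\ell$ of LMIs and the number $m$ of lifting variables being arbitrary finite), and $\operatorname{sxdeg}(C)=\infty$ if no such $d$ exists. *)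

theory Defs
  imports
    "HOL-Analysis.Analysis"
    "HOL-Computational_Algebra.Polynomial"
    "HOL-Library.Extended_Nat"
    "Jordan_Normal_Form.Matrix"
begin

text \<open>
  Points of the ambient space are of type \<open>real ^ 'n\<close>. The number \<open>m\<close> of lifting variables and the
  matrix sizes are bound inside the definition of a lifted representation, so lifting vectors
  and matrices are the carrier-based ones of \<^theory>\<open>Jordan_Normal_Form.Matrix\<close>. That theory
  reuses the type name \<open>vec\<close> and the symbol \<open>$\<close>, hence the qualified names below.
\<close>

text \<open>The Boolean algebra of subsets of the line generated by strict polynomial inequalities;
  equations and weak inequalities are obtained through complements and unions.\<close>

inductive semialgebraic :: "real set \<Rightarrow> bool" where
  pos: "semialgebraic {t. poly p t > 0}"
| compl: "semialgebraic A \<Longrightarrow> semialgebraic (- A)"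
| union: "semialgebraic A \<Longrightarrow> semialgebraic B \<Longrightarrow> semialgebraic (A \<union> B)"

definition symmetric_mat :: "real mat \<Rightarrow> bool" where
  "symmetric_mat A \<longleftrightarrow> transpose_mat A = A"

definition psd_mat :: "real mat \<Rightarrow> bool" where
  "psd_mat A \<longleftrightarrow> symmetric_mat A \<and>
     (\<forall>v \<in> carrier_vec (dim_row A). 0 \<le> scalar_prod v (A *\<^sub>v v))"

definition affine_linear :: "nat \<Rightarrow> (real ^ 'n \<Rightarrow> real Matrix.vec \<Rightarrow> real) \<Rightarrow> bool" where
  "affine_linear m f \<longleftrightarrow>
     (\<exists>c a. \<exists>b \<in> carrier_vec m. \<forall>x. \<forall>y \<in> carrier_vec m.
        f x y = c + inner a x + scalar_prod b y)"

text \<open>\<open>lmi_pencil d m M\<close>: \<open>psd_mat (M x y)\<close> is a linear matrix inequality of size \<open>d\<close> in \<open>(x, y)\<close>,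
  where \<open>y\<close> ranges over the real vectors of length \<open>m\<close>.\<close>

definition lmi_pencil ::
    "nat \<Rightarrow> nat \<Rightarrow> (real ^ 'n \<Rightarrow> real Matrix.vec \<Rightarrow> real mat) \<Rightarrow> bool" where
  "lmi_pencil d m M \<longleftrightarrow>
     (\<forall>x. \<forall>y \<in> carrier_vec m. M x y \<in> carrier_mat d d \<and> symmetric_mat (M x y)) \<and>
     (\<forall>i < d. \<forall>j < d. affine_linear m (\<lambda>x y. M x y $$ (i, j)))"

definition has_lifted_sdr :: "nat \<Rightarrow> (real ^ 'n) set \<Rightarrow> bool" where
  "has_lifted_sdr d C \<longleftrightarrow>
     (\<exists>m l. \<exists>M :: nat \<Rightarrow> real ^ 'n \<Rightarrow> real Matrix.vec \<Rightarrow> real mat.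
        (\<forall>k < l. \<exists>e \<le> d. lmi_pencil e m (M k)) \<and>
        C = {x. \<exists>y \<in> carrier_vec m. \<forall>k < l. psd_mat (M k x y)})"

text \<open>On \<^typ>\<open>enat\<close> the infimum of a nonempty set is its least element, and that of the empty set
  is \<open>\<infinity>\<close>.\<close>

definition sxdeg :: "(real ^ 'n) set \<Rightarrow> enat" where
  "sxdeg C = Inf {enat d |d. has_lifted_sdr d C}"

end

theory Submission
  imports Defs
begin

text \<open>
  Let \<open>p\<close> be a polynomial with at most \<open>n + 1\<close> monomials that is nonnegative on \<open>[a, b]\<close>, \<open>0 \<le> a < b\<close>.
  If \<open>p\<close> has \<open>n\<close> roots in \<open>(0, \<infinity>) \<inter> [a, b]\<close>, counted with multiplicity, then dividing them out leaves
  a polynomial whose coefficients all have the same sign: multiplying by \<open>t - x\<close> with \<open>x > 0\<close> creates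
  at least one new sign change, and \<open>n + 1\<close> monomials allow at most \<open>n\<close>. So \<open>p\<close> is a sum of products
  \<open>t ^ i * w * s\<^sup>2\<close> with \<open>w\<close> one of \<open>1\<close>, \<open>t - a\<close>, \<open>b - t\<close>, \<open>(t - a) * (b - t)\<close> and \<open>2 * degree s \<le> n\<close>.
  A \<open>p\<close> with fewer roots is a positive combination of nonnegative polynomials with the same monomials
  and more roots, or with fewer monomials, so such a representation always exists.

  Dually, a linear functional on the polynomials of degree at most \<open>d\<close> that satisfies the matrix
  inequalities of size \<open>n div 2 + 1\<close> belonging to these products is nonnegative on all such \<open>p\<close>. The
  closure of \<open>I\<close> is a finite union of intervals, each of which is brought into the form \<open>[a, b]\<close> by
  \<open>t \<mapsto> - t\<close> and \<open>t \<mapsto> 1 / t\<close>; one functional per interval, with sums prescribed by \<open>x\<close>, describes the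
  closed convex hull.
\<close>

subsection \<open>Sign changes and positive roots\<close>

text \<open>Sign variations as in Descartes' rule, counted by entries: a chain of \<open>k\<close>
  coefficients stands for \<open>k - 1\<close> sign changes. Only the sign of \<open>s\<close>
  matters.\<close>

fun alternates :: "real poly \<Rightarrow> nat \<Rightarrow> real \<Rightarrow> nat \<Rightarrow> bool" where
  "alternates p 0 s l \<longleftrightarrow> True"
| "alternates p (Suc k) s l \<longleftrightarrow> (\<exists>i\<ge>l. s * coeff p i > 0 \<and> alternates p k (- s) (Suc i))"

lemma alternates_mono: "alternates p k s l \<Longrightarrow> l' \<le> l \<Longrightarrow> alternates p k s l'"
  by (cases k) (auto intro: le_trans)

lemma finite_poly_support: "finite {i. coeff p i \<noteq> (0::real)}"
  by (rule finite_subset[of _ "{..degree p}"]) (auto simp: le_degree)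

lemma alternates_le_card:
  "alternates p k s l \<Longrightarrow> k \<le> card {i. l \<le> i \<and> coeff p i \<noteq> 0}"
proof (induction k arbitrary: s l)
  case (Suc k)
  then obtain i where i: "i \<ge> l" "s * coeff p i > 0" "alternates p k (- s) (Suc i)"
    by auto
  have "Suc k \<le> Suc (card {j. Suc i \<le> j \<and> coeff p j \<noteq> 0})"
    using Suc.IH[OF i(3)] by simp
  also have "\<dots> = card (insert i {j. Suc i \<le> j \<and> coeff p j \<noteq> 0})"
    by (subst card_insert_disjoint) (auto intro: finite_subset[OF _ finite_poly_support[of p]])
  also have "\<dots> \<le> card {j. l \<le> j \<and> coeff p j \<noteq> 0}"
    using i by (intro card_mono) (auto intro: finite_subset[OF _ finite_poly_support[of p]])
  finally show ?case .
qed simp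

lemma sum_coeff_linear_mult:
  "(\<Sum>i<k. x ^ i * coeff ([:- x, 1:] * h) i) = (if k = 0 then 0 else - (x ^ k * coeff h (k - 1)))"
  for x :: real
  by (induction k) (auto simp: coeff_pCons algebra_simps split: nat.splits)

text \<open>Abel summation: the partial sums of \<open>x ^ i * coeff ([:- x, 1:] * h) i\<close> are
  \<open>- x ^ (i + 1) * coeff h i\<close>, so between two of them of opposite sign there is a summand of the
  right sign, and one more at the end because the full sum vanishes.\<close>

lemma alternates_linear_mult_aux:
  fixes x :: real and h :: "real poly"
  defines "f \<equiv> [:- x, 1:] * h"
  defines "F \<equiv> \<lambda>k. \<Sum>i<k. x ^ i * coeff f i"
  assumes x: "x > 0"
  shows "alternates h k s l \<Longrightarrow> s * F l \<ge> 0 \<Longrightarrow> (k = 0 \<Longrightarrow> s * F l > 0)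
    \<Longrightarrow> alternates f (Suc k) (- s) l"
proof (induction k arbitrary: s l)
  case 0
  have "\<exists>i\<ge>l. s * coeff f i < 0"
  proof (rule ccontr)
    assume "\<not> ?thesis"
    then have *: "s * coeff f i \<ge> 0" if "i \<ge> l" for i using that by force
    \<comment> \<open>From index \<open>degree h + 2\<close> on, the partial sum
      \<open>- x ^ u * coeff h (u - 1)\<close> is zero.\<close>
    define u where "u = max l (Suc (Suc (degree h)))"
    have "F u = 0"
      unfolding F_def f_def by (subst sum_coeff_linear_mult) (auto simp: u_def intro!: coeff_eq_0)
    have "F u = F l + (\<Sum>i\<in>{l..<u}. x ^ i * coeff f i)"
      unfolding F_def by (metis atLeast0LessThan max.cobounded1 sum.atLeastLessThan_concat u_def zero_le)
    then have "s * F l + (\<Sum>i\<in>{l..<u}. x ^ i * (s * coeff f i)) = 0"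
      using \<open>F u = 0\<close>
      by (simp add: sum_distrib_left[symmetric] mult.left_commute flip: distrib_left)
    moreover have "(\<Sum>i\<in>{l..<u}. x ^ i * (s * coeff f i)) \<ge> 0"
      by (intro sum_nonneg mult_nonneg_nonneg[OF zero_le_power *]) (use x in auto)
    ultimately show False using 0 by simp
  qed
  then show ?case by auto
next
  case (Suc k)
  then obtain i where i: "i \<ge> l" "s * coeff h i > 0" "alternates h k (- s) (Suc i)"
    by auto
  have Fi: "F (Suc i) = - (x ^ Suc i * coeff h i)"
    unfolding F_def f_def by (subst sum_coeff_linear_mult) simp
  have "s * F (Suc i) = - (x ^ Suc i * (s * coeff h i))"
    unfolding Fi by simp
  also have "\<dots> < 0" using mult_pos_pos[OF zero_less_power[OF x] i(2)] by (simp only: neg_less_0_iff_less)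
  finally have neg: "s * F (Suc i) < 0" .
  have "\<exists>j\<in>{l..<Suc i}. s * coeff f j < 0"
  proof (rule ccontr)
    assume "\<not> ?thesis"
    then have *: "s * coeff f j \<ge> 0" if "j \<in> {l..<Suc i}" for j using that by (metis not_less)
    have "F (Suc i) = F l + (\<Sum>j\<in>{l..<Suc i}. x ^ j * coeff f j)"
      unfolding F_def using i(1)
      by (metis atLeast0LessThan le_SucI sum.atLeastLessThan_concat zero_le)
    then have "s * F (Suc i) = s * F l + (\<Sum>j\<in>{l..<Suc i}. x ^ j * (s * coeff f j))"
      by (simp add: sum_distrib_left mult.left_commute distrib_left)
    moreover have "(\<Sum>j\<in>{l..<Suc i}. x ^ j * (s * coeff f j)) \<ge> 0"
      by (intro sum_nonneg mult_nonneg_nonneg[OF zero_le_power *]) (use x in auto)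
    ultimately show False using Suc.prems neg by simp
  qed
  then obtain j where j: "l \<le> j" "j \<le> i" "s * coeff f j < 0" by auto
  have "alternates f (Suc k) (- (- s)) (Suc i)"
    by (rule Suc.IH[OF i(3)]) (use neg in auto)
  then have "alternates f (Suc k) s (Suc j)"
    using j alternates_mono[of f "Suc k" s "Suc i" "Suc j"] by (simp del: alternates.simps)
  then show ?case using j
    by (subst alternates.simps(2)) (auto simp del: alternates.simps intro!: exI[of _ j])
qed

text \<open>The step of Descartes' rule: at \<open>l = 0\<close> the partial sum is empty, hence
  zero, and \<open>k > 0\<close> discharges the strictness condition.\<close>

lemma alternates_linear_mult:
  assumes "x > 0" "k > 0" "alternates h k s 0"
  shows "alternates ([:- x, 1:] * h) (Suc k) (- s) 0"
  using alternates_linear_mult_aux[OF assms(1,3)] assms(2) by simp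

section \<open>Polynomials with prescribed positive roots\<close>

definition root_poly :: "real multiset \<Rightarrow> real poly" where
  "root_poly X = (\<Prod>x\<in>#X. [:- x, 1:])"

lemma root_poly_empty [simp]: "root_poly {#} = 1"
  and root_poly_add [simp]: "root_poly (add_mset x X) = [:- x, 1:] * root_poly X"
  by (simp_all add: root_poly_def)

lemma root_poly_nz [simp]: "root_poly X \<noteq> 0"
  by (induction X) (auto simp del: mult_pCons_left)

lemma degree_root_poly [simp]: "degree (root_poly X) = size X"
  by (induction X) (auto simp: degree_mult_eq simp del: mult_pCons_left)

lemma alternates_root_poly_mult:
  assumes "\<And>x. x \<in># X \<Longrightarrow> x > 0" "k > 0" "alternates h k s 0"
  shows "\<exists>s'. alternates (root_poly X * h) (k + size X) s' 0"
  using assms(1)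
proof (induction X)
  case empty
  then show ?case using assms by auto
next
  case (add x X)
  then obtain s' where "alternates (root_poly X * h) (k + size X) s' 0" by auto
  have "alternates ([:- x, 1:] * (root_poly X * h)) (Suc (k + size X)) (- s') 0"
    using add.prems assms(2) \<open>alternates _ _ s' 0\<close> by (intro alternates_linear_mult) auto
  then show ?case
    by (intro exI[of _ "- s'"]) (simp only: root_poly_add size_add_mset mult.assoc add_Suc_right)
qed

lemma alternates_Suc_0:
  assumes "h \<noteq> 0" shows "\<exists>s. alternates h 1 s 0"
proof -
  obtain i where "coeff h i \<noteq> 0" using assms by (meson leading_coeff_neq_0)
  then show ?thesis
    by (intro exI[of _ "coeff h i"]) (auto intro!: exI[of _ i] simp: not_square_less_zero zero_less_mult_iff)
qed

text \<open>A nonzero cofactor has a chain of length one, and each positive root lengthens the chain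
  by one: Descartes' bound on positive roots in terms of the number of monomials.\<close>

lemma card_support_gt_roots:
  assumes "root_poly X dvd p" "p \<noteq> 0" "\<And>x. x \<in># X \<Longrightarrow> x > 0"
  shows "size X < card {i. coeff p i \<noteq> 0}"
proof -
  obtain h where p: "p = root_poly X * h" using assms(1) by (elim dvdE)
  then obtain s where "alternates h 1 s 0" using alternates_Suc_0[of h] assms by auto
  with alternates_root_poly_mult[of X 1 h s] assms(3)
  have "\<exists>s'. alternates (root_poly X * h) (1 + size X) s' 0" by simp
  then obtain s' where "alternates p (1 + size X) s' 0" unfolding p ..
  from alternates_le_card[OF this] show ?thesis by simp
qed

text \<open>Two cofactor coefficients of opposite sign would form a chain of length two, and the
  product would need \<open>size X + 2\<close> monomials.\<close>

lemma cofactor_coeffs_same_sign: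
  assumes "card {i. coeff (root_poly X * h) i \<noteq> 0} \<le> size X + 1" "\<And>x. x \<in># X \<Longrightarrow> x > 0"
  shows "(\<forall>i. coeff h i \<ge> 0) \<or> (\<forall>i. coeff h i \<le> 0)"
proof (rule ccontr)
  assume "\<not> ?thesis"
  then obtain i j where ij: "coeff h i < 0" "coeff h j > 0" by (auto simp: not_le)
  have "\<exists>s. alternates h (Suc (Suc 0)) s 0"
  proof (cases "i < j")
    case True
    then have "alternates h (Suc (Suc 0)) (- 1) 0" using ij
      by (subst alternates.simps, intro exI[of _ i]) (auto intro!: exI[of _ j])
    then show ?thesis ..
  next
    case False
    then have "j < i" using ij by (metis linorder_neqE_nat order_less_asym)
    then have "alternates h (Suc (Suc 0)) 1 0" using ij
      by (subst alternates.simps, intro exI[of _ j]) (auto intro!: exI[of _ i])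
    then show ?thesis ..
  qed
  then obtain s where "alternates h (Suc (Suc 0)) s 0" ..
  with alternates_root_poly_mult[of X "Suc (Suc 0)" h s] obtain s' where
    "alternates (root_poly X * h) (Suc (Suc 0) + size X) s' 0" using assms(2) by blast
  from alternates_le_card[OF this] assms(1) show False by simp
qed

text \<open>Induction on the roots in place of a dimension count: two solutions for
  \<open>X\<close>, each avoiding a different exponent of \<open>D\<close>, are combined so that the
  new root is added, and Descartes' bound keeps the combination nonzero.\<close>

lemma ex_sparse_poly_with_roots:
  assumes "finite D" "card D = Suc (size X)" "\<And>x. x \<in># X \<Longrightarrow> x > 0"
  shows "\<exists>g. g \<noteq> 0 \<and> {i. coeff g i \<noteq> 0} \<subseteq> D \<and> root_poly X dvd g"
  using assms
proof (induction X arbitrary: D)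
  case empty
  then obtain i where "D = {i}" by (auto simp: card_Suc_eq)
  then show ?case
    by (intro exI[of _ "monom 1 i"]) auto
next
  case (add \<xi> X)
  obtain x y where xy: "x \<in> D" "y \<in> D" "x \<noteq> y"
    using add.prems(1,2) card_le_Suc0_iff_eq[of D] by force
  have "card (D - {z}) = Suc (size X)" if "z \<in> D" for z
    using add.prems that by simp
  then have "\<exists>g. g \<noteq> 0 \<and> {i. coeff g i \<noteq> 0} \<subseteq> D - {z} \<and> root_poly X dvd g" if "z \<in> D" for z
    using that add.prems by (intro add.IH) auto
  then obtain g1 g2 where g1: "g1 \<noteq> 0" "{i. coeff g1 i \<noteq> 0} \<subseteq> D - {x}" "root_poly X dvd g1"
    and g2: "g2 \<noteq> 0" "{i. coeff g2 i \<noteq> 0} \<subseteq> D - {y}" "root_poly X dvd g2"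
    using xy by metis
  obtain h1 h2 where h: "g1 = root_poly X * h1" "g2 = root_poly X * h2"
    using g1(3) g2(3) by (elim dvdE)
  show ?case
  proof (cases "poly h1 \<xi> = 0")
    case True
    then have "root_poly (add_mset \<xi> X) dvd g1"
      using h(1) by (simp add: poly_eq_0_iff_dvd mult.commute mult_dvd_mono del: mult_pCons_left mult_pCons_right)
    then show ?thesis using g1 by blast
  next
    case False
    define g where "g = Polynomial.smult (poly h2 \<xi>) g1 - Polynomial.smult (poly h1 \<xi>) g2"
    have gh: "g = root_poly X * (Polynomial.smult (poly h2 \<xi>) h1 - Polynomial.smult (poly h1 \<xi>) h2)"
      by (simp add: g_def h algebra_simps)
    have "[:- \<xi>, 1:] dvd Polynomial.smult (poly h2 \<xi>) h1 - Polynomial.smult (poly h1 \<xi>) h2"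
      by (simp flip: poly_eq_0_iff_dvd)
    then have dvd: "root_poly (add_mset \<xi> X) dvd g"
      unfolding gh by (simp add: mult.commute mult_dvd_mono del: mult_pCons_left mult_pCons_right)
    have sup: "{i. coeff g i \<noteq> 0} \<subseteq> D"
      using g1(2) g2(2) by (auto simp: g_def) (metis (mono_tags, lifting) Diff_iff mem_Collect_eq mult_zero_right subset_eq)
    \<comment> \<open>Otherwise \<open>g2\<close> would have at most \<open>size X\<close>
      monomials, too few for its \<open>size X\<close> positive roots.\<close>
    have "coeff g2 x \<noteq> 0"
    proof
      assume "coeff g2 x = 0"
      then have "{i. coeff g2 i \<noteq> 0} \<subseteq> D - {x, y}" using g2(2) by auto
      then have "card {i. coeff g2 i \<noteq> 0} \<le> card (D - {x, y})"
        using add.prems by (intro card_mono) auto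
      also have "\<dots> = size X" using add.prems xy by (simp add: card_Diff_subset)
      finally show False using card_support_gt_roots[OF g2(3,1)] add.prems by force
    qed
    moreover have "coeff g1 x = 0" using g1 by auto
    ultimately have "coeff g x \<noteq> 0" using False by (simp add: g_def)
    then have "g \<noteq> 0" by auto
    then show ?thesis using sup dvd by blast
  qed
qed

subsection \<open>Products of squares and weights\<close>

text \<open>Needed because the arguments below divide by factors that may vanish at
  \<open>a = 0\<close>, and so give nonnegativity only to the right of \<open>a\<close>.\<close>

lemma poly_nonneg_at_left_end:
  fixes f :: "real poly"
  assumes "a < b" "\<And>t. a < t \<Longrightarrow> t \<le> b \<Longrightarrow> poly f t \<ge> 0"
  shows "poly f a \<ge> 0"
proof (rule tendsto_lowerbound)
  show "(poly f \<longlongrightarrow> poly f a) (at_right a)"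
    using poly_isCont[of a f] by (auto simp: isCont_def filterlim_at_split)
  show "\<forall>\<^sub>F t in at_right a. 0 \<le> poly f t"
    using assms(1) by (intro eventually_at_rightI[of a b]) (auto intro: assms(2))
qed auto

text \<open>If \<open>f\<close> were negative at \<open>t\<close>, it would be so near
  \<open>t\<close>, and \<open>s\<close> would have to vanish at infinitely many points.\<close>

lemma poly_nonneg_of_square_mult:
  fixes f s :: "real poly"
  assumes "a < b" "s \<noteq> 0" "\<And>t. t \<in> {a..b} \<Longrightarrow> poly (s\<^sup>2 * f) t \<ge> 0" "t \<in> {a..b}"
  shows "poly f t \<ge> 0"
proof (rule ccontr)
  assume neg: "\<not> ?thesis"
  have "poly f \<midarrow>t\<rightarrow> poly f t" using poly_isCont[of t f] by (simp add: isCont_def)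
  then obtain \<delta> where \<delta>: "\<delta> > 0" "\<And>u. u \<noteq> t \<Longrightarrow> \<bar>t - u\<bar> < \<delta> \<Longrightarrow> poly f u < 0"
    using LIM_fun_less_zero[of "poly f" "poly f t" t] neg by force
  have "{max a (t - \<delta>)<..<min b (t + \<delta>)} \<subseteq> {u. poly s u = 0}"
  proof
    fix u assume u: "u \<in> {max a (t - \<delta>)<..<min b (t + \<delta>)}"
    then have "poly f u < 0" "(poly s u)\<^sup>2 * poly f u \<ge> 0"
      using \<delta>(2)[of u] neg assms(3)[of u] by (cases "u = t"; auto)+
    then show "u \<in> {u. poly s u = 0}"
      by (metis mem_Collect_eq mult_pos_neg not_less zero_less_power2)
  qed
  moreover have "infinite {max a (t - \<delta>)<..<min b (t + \<delta>)}"
    using assms \<delta> by (subst infinite_Ioo_iff) auto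
  ultimately show False using poly_roots_finite[OF assms(2)] finite_subset by blast
qed

definition weights :: "real \<Rightarrow> real \<Rightarrow> real poly set" where
  "weights a b = {1, [:- a, 1:], [:b, - 1:], [:- a, 1:] * [:b, - 1:]}"

lemma weights_nonneg: "w \<in> weights a b \<Longrightarrow> t \<in> {a..b} \<Longrightarrow> poly w t \<ge> 0"
  by (auto simp: weights_def simp del: mult_pCons_left mult_pCons_right)

lemma root_poly_zeroD:
  "poly (root_poly X) x = 0 \<Longrightarrow> x \<in># X"
  by (induction X) (auto simp del: mult_pCons_left)

text \<open>A root in the open interval would be a local minimum, so the derivative would vanish
  there although the root is simple. Hence \<open>Y\<close> consists of endpoints, and the four
  subsets of \<open>{a, b}\<close> yield the four weights up to a positive factor.\<close>

lemma nonneg_root_poly_set: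
  fixes \<epsilon> :: real
  assumes ab: "a < b" and Y: "finite Y" "Y \<subseteq> {a..b}" and \<epsilon>: "\<epsilon> \<noteq> 0"
    and nn: "\<And>t. t \<in> {a..b} \<Longrightarrow> poly (Polynomial.smult \<epsilon> (root_poly (mset_set Y))) t \<ge> 0"
  shows "\<exists>c>0. \<exists>w\<in>weights a b. degree w = card Y \<and>
    Polynomial.smult \<epsilon> (root_poly (mset_set Y)) = Polynomial.smult c w"
proof -
  have "Y \<subseteq> {a, b}"
  proof
    fix x assume x: "x \<in> Y"
    define r where "r = root_poly (mset_set (Y - {x}))"
    have *: "root_poly (mset_set Y) = [:- x, 1:] * r"
      using x Y by (simp add: r_def mset_set.remove del: mult_pCons_left)
    have "poly r x \<noteq> 0"
      using root_poly_zeroD[of "mset_set (Y - {x})" x] Y by (auto simp: r_def)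
    show "x \<in> {a, b}"
    proof (rule ccontr)
      assume "x \<notin> {a, b}"
      then have ax: "a < x" "x < b" using x Y by force+
      define f where "f = Polynomial.smult \<epsilon> (root_poly (mset_set Y))"
      have "DERIV (poly f) x :> poly (pderiv f) x" by (rule poly_DERIV)
      moreover have "0 < min (x - a) (b - x)" using ax by auto
      moreover have "\<forall>y. \<bar>x - y\<bar> < min (x - a) (b - x) \<longrightarrow> poly f x \<le> poly f y"
      proof (intro allI impI)
        fix y assume "\<bar>x - y\<bar> < min (x - a) (b - x)"
        then have "y \<in> {a..b}" by auto
        then show "poly f x \<le> poly f y" using nn[of y] by (simp add: f_def *)
      qed
      ultimately have "poly (pderiv f) x = 0" by (rule DERIV_local_min)
      then show False using \<open>poly r x \<noteq> 0\<close> \<epsilon>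
        by (simp add: f_def * pderiv_smult pderiv_mult pderiv_pCons del: mult_pCons_left)
    qed
  qed
  then consider "Y = {}" | "Y = {a}" | "Y = {b}" | "Y = {a, b}" by blast
  then show ?thesis
  proof cases
    case 1
    then have "\<epsilon> > 0" using nn[of a] ab \<epsilon> by auto
    then show ?thesis using 1 by (intro exI[of _ \<epsilon>]) (auto simp: weights_def)
  next
    case 2
    then have "\<epsilon> > 0" using nn[of b] ab \<epsilon> by (auto simp: zero_le_mult_iff)
    then show ?thesis using 2 by (intro exI[of _ \<epsilon>]) (auto simp: weights_def)
  next
    case 3
    then have "\<epsilon> < 0" using nn[of a] ab \<epsilon> by (auto simp: zero_le_mult_iff)
    then show ?thesis using 3 by (intro exI[of _ "- \<epsilon>"]) (auto simp: weights_def)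
  next
    case 4
    \<comment> \<open>With both endpoints as roots, the midpoint decides the sign of
      \<open>\<epsilon>\<close>.\<close>
    have "poly (Polynomial.smult \<epsilon> (root_poly (mset_set Y))) ((a + b) / 2) = - (\<epsilon> * ((b - a) / 2)\<^sup>2)"
      using 4 ab by (simp add: field_simps power2_eq_square)
    moreover have "((b - a) / 2)\<^sup>2 > 0" using ab by simp
    ultimately have "\<epsilon> < 0" using nn[of "(a + b) / 2"] ab \<epsilon>
      by (auto simp: mult_le_0_iff)
    then show ?thesis using 4 ab
      by (intro exI[of _ "- \<epsilon>"]) (auto simp: weights_def field_simps)
  qed
qed

text \<open>Pairs of equal roots go into the square.\<close>

lemma root_poly_square_split:
  "\<exists>s Y. finite Y \<and> Y \<subseteq> set_mset X \<and> s \<noteq> 0 \<and> root_poly X = s\<^sup>2 * root_poly (mset_set Y)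
     \<and> 2 * degree s + card Y = size X"
proof (induction X)
  case empty
  then show ?case by (intro exI[of _ 1] exI[of _ "{}"]) auto
next
  case (add x X)
  then obtain s Y where IH: "finite Y" "Y \<subseteq> set_mset X" "s \<noteq> 0"
    "root_poly X = s\<^sup>2 * root_poly (mset_set Y)" "2 * degree s + card Y = size X"
    by auto
  show ?case
  proof (cases "x \<in> Y")
    case False
    then show ?thesis using IH
      by (intro exI[of _ s] exI[of _ "insert x Y"]) (auto simp del: mult_pCons_left mult_pCons_right)
  next
    case True
    then have "root_poly (mset_set Y) = [:- x, 1:] * root_poly (mset_set (Y - {x}))"
      using IH(1) by (simp add: mset_set.remove del: mult_pCons_left)
    moreover have "card Y = Suc (card (Y - {x}))"
      using True IH(1) by (metis card.remove)
    ultimately show ?thesis using IH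
      by (intro exI[of _ "[:- x, 1:] * s"] exI[of _ "Y - {x}"])
        (auto simp: power2_eq_square degree_mult_eq mult_ac simp del: mult_pCons_left mult_pCons_right)
  qed
qed

section \<open>Truncated cones of weighted squares\<close>

lemma smult_sum_right: "Polynomial.smult c (sum f A) = (\<Sum>i\<in>A. Polynomial.smult c (f i))"
  by (induction A rule: infinite_finite_induct) (simp_all add: smult_add_right)

text \<open>\<open>N div 2\<close> limits the squared factor and with it the matrix size, while
  \<open>d\<close> limits the total degree. The power \<open>monom 1 i\<close> stays outside the
  square, so large exponents do not enlarge the matrices.\<close>

inductive_set sos_cone :: "real \<Rightarrow> real \<Rightarrow> nat \<Rightarrow> nat \<Rightarrow> real poly set" for a b N d where
  gen: "w \<in> weights a b \<Longrightarrow> degree s \<le> N div 2 \<Longrightarrow> i + degree w + 2 * degree s \<le> d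
    \<Longrightarrow> monom 1 i * w * s\<^sup>2 \<in> sos_cone a b N d"
| zero: "0 \<in> sos_cone a b N d"
| add: "p \<in> sos_cone a b N d \<Longrightarrow> q \<in> sos_cone a b N d \<Longrightarrow> p + q \<in> sos_cone a b N d"

lemma sos_cone_mono:
  assumes "p \<in> sos_cone a b N d" "N \<le> N'" "d \<le> d'"
  shows "p \<in> sos_cone a b N' d'"
  using assms(1)
proof induction
  case (gen w s i)
  have "N div 2 \<le> N' div 2" using assms by (intro div_le_mono)
  with gen show ?case using assms by (intro sos_cone.gen) linarith+
qed (auto intro: sos_cone.intros)

lemma sos_cone_smult:
  assumes "p \<in> sos_cone a b N d" "c \<ge> 0"
  shows "Polynomial.smult c p \<in> sos_cone a b N d"
  using assms(1)
proof induction
  case (gen w s i)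
  have "Polynomial.smult c (monom 1 i * w * s\<^sup>2) = monom 1 i * w * (Polynomial.smult (sqrt c) s)\<^sup>2"
    using assms(2) by (simp add: smult_power)
  then show ?case using gen degree_smult_le[of "sqrt c" s]
    by (auto intro!: sos_cone.gen)
qed (auto intro: sos_cone.intros simp: smult_add_right)

lemma sos_cone_monom_mult:
  assumes "p \<in> sos_cone a b N d"
  shows "monom 1 j * p \<in> sos_cone a b N (j + d)"
  using assms
proof induction
  case (gen w s i)
  have "monom 1 j * (monom 1 i * w * s\<^sup>2) = monom 1 (j + i) * w * s\<^sup>2"
    by (simp add: mult_monom flip: mult.assoc)
  moreover have "monom 1 (j + i) * w * s\<^sup>2 \<in> sos_cone a b N (j + d)"
    using gen by (intro sos_cone.gen) auto
  ultimately show ?case by metis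
qed (auto intro: sos_cone.intros simp: algebra_simps)

lemma sos_cone_sum:
  "(\<And>i. i \<in> A \<Longrightarrow> f i \<in> sos_cone a b N d) \<Longrightarrow> sum f A \<in> sos_cone a b N d"
  by (induction A rule: infinite_finite_induct) (auto intro: sos_cone.intros)

text \<open>The extremal case, with all the positive roots that the number of monomials permits. The
  cofactor has coefficients of one sign, so up to this sign \<open>root_poly X\<close> is
  nonnegative on the interval and splits into a square and a weight; the terms of the cofactor
  provide the powers \<open>monom 1 i\<close>.\<close>

lemma sos_cone_all_roots:
  fixes p :: "real poly"
  assumes ab: "0 \<le> a" "a < b" and p: "p \<noteq> 0" "p = root_poly X * h"
    and X: "\<And>x. x \<in># X \<Longrightarrow> 0 < x" "set_mset X \<subseteq> {a..b}"
    and card: "card {i. coeff p i \<noteq> 0} \<le> size X + 1"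
    and nn: "\<And>t. t \<in> {a..b} \<Longrightarrow> poly p t \<ge> 0" and deg: "degree p \<le> d"
  shows "p \<in> sos_cone a b (size X) d"
proof -
  have "(\<forall>i. coeff h i \<ge> 0) \<or> (\<forall>i. coeff h i \<le> 0)"
    using cofactor_coeffs_same_sign[of X h] card X(1) unfolding p(2) by blast
  then obtain \<epsilon> :: real where \<epsilon>: "\<epsilon> = 1 \<or> \<epsilon> = -1" "\<And>i. \<epsilon> * coeff h i \<ge> 0"
    by (metis mult_1 mult_minus1 neg_0_le_iff_le)
  have hnz: "h \<noteq> 0" using p by auto
  have hpos: "\<epsilon> * poly h t > 0" if "t > 0" for t
  proof -
    have "\<epsilon> * poly h t = (\<Sum>i\<le>degree h. (\<epsilon> * coeff h i) * t ^ i)"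
      by (simp add: poly_altdef sum_distrib_left mult.assoc)
    also have "\<dots> > 0"
    proof (rule sum_pos2[of _ "degree h"])
      have "\<epsilon> * lead_coeff h \<noteq> 0" using hnz \<epsilon>(1) by auto
      then have "\<epsilon> * lead_coeff h > 0" using \<epsilon>(2)[of "degree h"] by linarith
      then show "0 < \<epsilon> * lead_coeff h * t ^ degree h" using that by simp
      show "0 \<le> \<epsilon> * coeff h i * t ^ i" for i
        using mult_nonneg_nonneg[OF \<epsilon>(2)[of i], of "t ^ i"] that by simp
    qed auto
    finally show ?thesis .
  qed
  obtain s Y where sY: "finite Y" "Y \<subseteq> set_mset X" "s \<noteq> 0"
    "root_poly X = s\<^sup>2 * root_poly (mset_set Y)" "2 * degree s + card Y = size X"
    using root_poly_square_split by metis
  \<comment> \<open>The point \<open>a\<close> is left out since \<open>h\<close> may vanish there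
    if \<open>a = 0\<close>.\<close>
  have *: "poly (s\<^sup>2 * Polynomial.smult \<epsilon> (root_poly (mset_set Y))) t \<ge> 0" if t: "a < t" "t \<le> b" for t
  proof -
    have "\<epsilon> * \<epsilon> = 1" using \<epsilon>(1) by auto
    then have "poly p t = (\<epsilon> * poly (root_poly X) t) * (\<epsilon> * poly h t)"
      by (simp add: p(2) mult_ac)
    moreover have "poly p t \<ge> 0" using nn t by auto
    ultimately have "\<epsilon> * poly (root_poly X) t \<ge> 0"
      using hpos[of t] ab t by (simp add: zero_le_mult_iff)
    then show ?thesis by (simp add: sY(4) mult_ac)
  qed
  have nnY: "poly (Polynomial.smult \<epsilon> (root_poly (mset_set Y))) t \<ge> 0" if "t \<in> {a..b}" for t
  proof (rule poly_nonneg_of_square_mult[OF ab(2) sY(3) _ that])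
    fix u assume "u \<in> {a..b}"
    then show "poly (s\<^sup>2 * Polynomial.smult \<epsilon> (root_poly (mset_set Y))) u \<ge> 0"
      using * poly_nonneg_at_left_end[OF ab(2), of "s\<^sup>2 * Polynomial.smult \<epsilon> (root_poly (mset_set Y))"]
      by (cases "u = a") auto
  qed
  obtain c w where cw: "c > 0" "w \<in> weights a b" "degree w = card Y"
    "Polynomial.smult \<epsilon> (root_poly (mset_set Y)) = Polynomial.smult c w"
    using nonneg_root_poly_set[OF ab(2) sY(1) _ _ nnY] sY(2) X(2) \<epsilon>(1) by (metis order.trans zero_neq_one zero_neq_neg_one)
  have "p = Polynomial.smult \<epsilon> (root_poly X) * Polynomial.smult \<epsilon> h"
    using \<epsilon>(1) by (auto simp: p(2))
  also have "Polynomial.smult \<epsilon> (root_poly X) = Polynomial.smult c (w * s\<^sup>2)"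
    using cw(4) by (metis mult.commute mult_smult_right sY(4))
  also have "Polynomial.smult \<epsilon> h = (\<Sum>i\<le>degree h. monom (\<epsilon> * coeff h i) i)"
    by (subst poly_as_sum_of_monoms[of h, symmetric]) (simp add: smult_sum_right smult_monom)
  also have "Polynomial.smult c (w * s\<^sup>2) * \<dots>
      = (\<Sum>i\<le>degree h. Polynomial.smult (c * (\<epsilon> * coeff h i)) (monom 1 i * w * s\<^sup>2))"
  proof -
    have "Polynomial.smult c (w * s\<^sup>2) * monom e i = Polynomial.smult (c * e) (monom 1 i * w * s\<^sup>2)" for e i
    proof -
      have "monom e i = Polynomial.smult e (monom 1 i)" by (simp add: smult_monom)
      then show ?thesis by (simp add: mult_ac)
    qed
    then show ?thesis by (simp only: sum_distrib_left)
  qed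
  also have "\<dots> \<in> sos_cone a b (size X) d"
  proof (intro sos_cone_sum sos_cone_smult sos_cone.gen)
    fix i assume i: "i \<in> {..degree h}"
    show "w \<in> weights a b" by fact
    show "degree s \<le> size X div 2" using sY(5) by linarith
    have "degree p = size X + degree h"
      using hnz by (simp add: p(2) degree_mult_eq)
    then show "i + degree w + 2 * degree s \<le> d" using i sY(5) cw(3) deg by auto
    show "0 \<le> c * (\<epsilon> * coeff h i)" using cw(1) \<epsilon>(2) by simp
  qed
  finally show ?thesis .
qed

subsection \<open>A Positivstellensatz for sparse polynomials\<close>

text \<open>If the cofactor \<open>h\<close> of \<open>root_poly X\<close> in \<open>p\<close> has no further root on \<open>[a, b]\<close>, take \<open>g \<noteq> 0\<close>
  supported on \<open>D\<close> and divisible by \<open>root_poly X\<close> and by \<open>t - b\<close>. With \<open>M\<close> the maximum of \<open>g / p\<close>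
  and \<open>M'\<close> that of \<open>- g / p\<close>, both \<open>M * p - g\<close> and \<open>M' * p + g\<close> are nonnegative and have one root
  more than \<open>p\<close>; the factor \<open>t - b\<close> makes \<open>M\<close> and \<open>M'\<close> nonnegative.\<close>

lemma sos_cone_by_roots:
  fixes p :: "real poly"
  assumes ab: "0 \<le> a" "a < b" and D: "finite D" "card D = N + 1" "D \<subseteq> {..d}" "0 \<in> D"
    and fewer: "\<And>p :: real poly. card {i. coeff p i \<noteq> 0} \<le> N \<Longrightarrow> degree p \<le> d \<Longrightarrow>
      (\<forall>t\<in>{a..b}. poly p t \<ge> 0) \<Longrightarrow> p \<in> sos_cone a b N d"
  shows "{i. coeff p i \<noteq> 0} \<subseteq> D \<Longrightarrow> \<forall>t\<in>{a..b}. poly p t \<ge> 0 \<Longrightarrow> root_poly X dvd p \<Longrightarrow>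
    set_mset X \<subseteq> {a..b} \<Longrightarrow> (\<forall>x\<in>#X. 0 < x) \<Longrightarrow> size X \<le> N \<Longrightarrow> p \<in> sos_cone a b N d"
proof (induction "N - size X" arbitrary: X p rule: less_induct)
  case less
  have deg: "degree p \<le> d" if "{i. coeff p i \<noteq> 0} \<subseteq> D" for p :: "real poly"
  proof (cases "p = 0")
    case False
    then have "degree p \<in> {i. coeff p i \<noteq> 0}" by simp
    then show ?thesis using that D(3) by blast
  qed simp
  \<comment> \<open>A root at \<open>0\<close> cannot join \<open>X\<close>, whose elements are
    positive; it removes the constant term instead and so lowers the number of monomials.\<close>
  have zero_at_0: "p \<in> sos_cone a b N d"
    if "{i. coeff p i \<noteq> 0} \<subseteq> D" "\<forall>t\<in>{a..b}. poly p t \<ge> 0" "poly p 0 = 0" for p :: "real poly"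
  proof (rule fewer[OF _ deg[OF that(1)] that(2)])
    have "{i. coeff p i \<noteq> 0} \<subseteq> D - {0}" using that by (auto simp: poly_0_coeff_0)
    then have "card {i. coeff p i \<noteq> 0} \<le> card (D - {0})" using D by (intro card_mono) auto
    then show "card {i. coeff p i \<noteq> 0} \<le> N" using D by simp
  qed
  have more_roots: "p' \<in> sos_cone a b N d"
    if "{i. coeff p' i \<noteq> 0} \<subseteq> D" "\<forall>t\<in>{a..b}. poly p' t \<ge> 0" "p' = root_poly X * h'"
      "poly h' x = 0" "x \<in> {a..b}" "size X < N" for p' h' x
  proof (cases "x = 0")
    case True
    then have "poly p' 0 = 0" using that by simp
    then show ?thesis using zero_at_0 that by blast
  next
    case False
    show ?thesis
    proof (rule less.hyps[of "add_mset x X"])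
      show "root_poly (add_mset x X) dvd p'"
        using that(3,4) by (simp add: poly_eq_0_iff_dvd mult.commute mult_dvd_mono
          del: mult_pCons_left mult_pCons_right)
    qed (use that less.prems False ab in auto)
  qed
  obtain h where h: "p = root_poly X * h" using less.prems(3) by (elim dvdE)
  consider "p = 0" | "poly p 0 = 0" | "p \<noteq> 0" "size X = N"
    | x where "size X < N" "x \<in> {a..b}" "poly h x = 0"
    | "poly p 0 \<noteq> 0" "size X < N" "\<forall>x\<in>{a..b}. poly h x \<noteq> 0"
    using less.prems(6) by (metis le_neq_implies_less)
  then show ?case
  proof cases
    case 1
    then show ?thesis by (simp add: sos_cone.zero)
  next
    case 2
    then show ?thesis using zero_at_0 less.prems by blast
  next
    case 3
    have "card {i. coeff p i \<noteq> 0} \<le> size X + 1"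
      using card_mono[OF D(1) less.prems(1)] D(2) 3 by simp
    from sos_cone_all_roots[OF ab 3(1) h _ less.prems(4) this _ deg[OF less.prems(1)]]
    show ?thesis using less.prems 3 by auto
  next
    case 4
    then show ?thesis using more_roots h less.prems by blast
  next
    case 5
    \<comment> \<open>\<open>size X + 1\<close> roots need \<open>size X + 2\<close> exponents,
      available because \<open>size X < N\<close>.\<close>
    obtain D' where D': "D' \<subseteq> D" "card D' = Suc (size (add_mset b X))"
      using obtain_subset_with_card_n[of "Suc (size (add_mset b X))" D] 5(2) D(2) by auto
    then have "finite D'" using D finite_subset by blast
    then obtain g where g: "g \<noteq> 0" "{i. coeff g i \<noteq> 0} \<subseteq> D'" "root_poly (add_mset b X) dvd g"
    proof -
      have "\<exists>g. g \<noteq> 0 \<and> {i. coeff g i \<noteq> 0} \<subseteq> D' \<and> root_poly (add_mset b X) dvd g"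
        using less.prems(5) ab \<open>finite D'\<close> D'(2) by (intro ex_sparse_poly_with_roots) auto
      then show ?thesis using that by blast
    qed
    obtain k where "g = root_poly (add_mset b X) * k" using g(3) by (elim dvdE)
    define h' where "h' = [:- b, 1:] * k"
    have gh: "g = root_poly X * h'" and hb: "poly h' b = 0"
      using \<open>g = _\<close> by (simp_all add: h'_def mult_ac del: mult_pCons_left mult_pCons_right)
    have key: "\<exists>M\<ge>0. (\<forall>t\<in>{a..b}. poly h' t / poly h t * \<epsilon> \<le> M)
        \<and> Polynomial.smult M p - Polynomial.smult \<epsilon> g \<in> sos_cone a b N d" for \<epsilon> :: real
    proof -
      \<comment> \<open>This is \<open>g / p\<close> times \<open>\<epsilon>\<close>, with the
        factor \<open>root_poly X\<close> cancelled; \<open>h\<close> has no root on the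
        interval.\<close>
      have "continuous_on {a..b} (\<lambda>t. poly h' t / poly h t * \<epsilon>)"
        using 5(3) by (intro continuous_intros) auto
      then obtain x where x: "x \<in> {a..b}"
        "\<forall>t\<in>{a..b}. poly h' t / poly h t * \<epsilon> \<le> poly h' x / poly h x * \<epsilon>"
        using continuous_attains_sup[of "{a..b}" "\<lambda>t. poly h' t / poly h t * \<epsilon>"] ab by auto
      define M where "M = poly h' x / poly h x * \<epsilon>"
      define r where "r = Polynomial.smult M h - Polynomial.smult \<epsilon> h'"
      have "M \<ge> 0" using x(2)[rule_format, of b] hb ab by (simp add: M_def)
      have eq: "Polynomial.smult M p - Polynomial.smult \<epsilon> g = root_poly X * r"
        by (simp add: r_def gh h algebra_simps)
      have "Polynomial.smult M p - Polynomial.smult \<epsilon> g \<in> sos_cone a b N d"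
      proof (rule more_roots[OF _ _ eq _ x(1) 5(2)])
        show "{i. coeff (Polynomial.smult M p - Polynomial.smult \<epsilon> g) i \<noteq> 0} \<subseteq> D"
        proof (rule subsetI, rule ccontr)
          fix i assume i: "i \<in> {i. coeff (Polynomial.smult M p - Polynomial.smult \<epsilon> g) i \<noteq> 0}" "i \<notin> D"
          then have "coeff p i = 0" "coeff g i = 0" using g(2) D'(1) less.prems(1) by auto
          then show False using i by simp
        qed
        show "poly r x = 0" using 5(3) x(1) by (auto simp: r_def M_def)
        show "\<forall>t\<in>{a..b}. 0 \<le> poly (Polynomial.smult M p - Polynomial.smult \<epsilon> g) t"
        proof
          fix t assume t: "t \<in> {a..b}"
          have "poly (Polynomial.smult M p - Polynomial.smult \<epsilon> g) t
            = poly p t * (M - poly h' t / poly h t * \<epsilon>)"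
            using 5(3) t by (simp add: h gh field_simps)
          moreover have "poly p t \<ge> 0" using less.prems(2) t by auto
          moreover have "M - poly h' t / poly h t * \<epsilon> \<ge> 0" using x(2) t by (simp add: M_def)
          ultimately show "0 \<le> poly (Polynomial.smult M p - Polynomial.smult \<epsilon> g) t" by simp
        qed
      qed
      then show ?thesis using \<open>M \<ge> 0\<close> x(2) unfolding M_def by blast
    qed
    obtain M1 where M1: "M1 \<ge> 0" "\<forall>t\<in>{a..b}. poly h' t / poly h t \<le> M1"
      "Polynomial.smult M1 p - g \<in> sos_cone a b N d" using key[of 1] by auto
    obtain M2 where M2: "M2 \<ge> 0" "\<forall>t\<in>{a..b}. - (poly h' t / poly h t) \<le> M2"
      "Polynomial.smult M2 p + g \<in> sos_cone a b N d" using key[of "-1"] by auto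
    \<comment> \<open>If both bounds were zero, \<open>h'\<close> would vanish on the whole
      interval, and \<open>g\<close> would be zero.\<close>
    have "M1 + M2 \<noteq> 0"
    proof
      assume "M1 + M2 = 0"
      then have "M1 = 0" "M2 = 0" using M1 M2 by auto
      then have "poly h' t = 0" if "t \<in> {a..b}" for t
        using that M1(2)[rule_format, OF that] M2(2)[rule_format, OF that] 5(3) by (auto simp: divide_le_0_iff zero_le_divide_iff)
      then have "{a..b} \<subseteq> {t. poly h' t = 0}" by auto
      moreover have "infinite {a..b}" using ab by (simp add: infinite_Icc_iff)
      ultimately have "h' = 0" using poly_roots_finite finite_subset by blast
      then show False using g(1) gh by simp
    qed
    have "(Polynomial.smult M1 p - g) + (Polynomial.smult M2 p + g) \<in> sos_cone a b N d"
      using M1(3) M2(3) by (rule sos_cone.add)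
    then have "Polynomial.smult (M1 + M2) p \<in> sos_cone a b N d"
      by (simp add: smult_add_left)
    then have "Polynomial.smult (1 / (M1 + M2)) (Polynomial.smult (M1 + M2) p) \<in> sos_cone a b N d"
      by (rule sos_cone_smult) (use M1 M2 in auto)
    then show ?thesis using \<open>M1 + M2 \<noteq> 0\<close> by simp
  qed
qed

text \<open>Induction on the number of monomials. The power of \<open>t\<close> of lowest exponent
  is divided out first, because \<open>sos_cone_by_roots\<close> requires the exponent
  \<open>0\<close>, and is multiplied back at the end; meanwhile the degree bound drops to
  \<open>d - j\<close>.\<close>

theorem sparse_nonneg_in_sos_cone:
  fixes p :: "real poly"
  assumes ab: "0 \<le> a" "a < b"
  shows "card {i. coeff p i \<noteq> 0} \<le> N + 1 \<Longrightarrow> degree p \<le> d \<Longrightarrow> \<forall>t\<in>{a..b}. poly p t \<ge> 0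
    \<Longrightarrow> p \<in> sos_cone a b N d"
proof (induction N arbitrary: p d rule: less_induct)
  case (less N)
  have fewer: "p \<in> sos_cone a b N d"
    if p: "card {i. coeff p i \<noteq> 0} \<le> N" "degree p \<le> d" "\<forall>t\<in>{a..b}. poly p t \<ge> 0" for p :: "real poly" and d
  proof (cases "N = 0")
    case True
    then have "p = 0" using p finite_poly_support[of p] by (auto simp: poly_eq_iff)
    then show ?thesis by (simp add: sos_cone.zero)
  next
    case False
    then have "p \<in> sos_cone a b (N - 1) d" using p by (intro less.IH) auto
    then show ?thesis by (rule sos_cone_mono) auto
  qed
  show ?case
  proof (cases "card {i. coeff p i \<noteq> 0} \<le> N")
    case True
    then show ?thesis using fewer less.prems by blast
  next
    case False
    then have card: "card {i. coeff p i \<noteq> 0} = N + 1" using less.prems by simp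
    then have "p \<noteq> 0" by auto
    define j where "j = (LEAST i. coeff p i \<noteq> 0)"
    have "\<exists>i. coeff p i \<noteq> 0" using \<open>p \<noteq> 0\<close> leading_coeff_neq_0 by blast
    then have j: "coeff p j \<noteq> 0" unfolding j_def by (rule LeastI_ex)
    have lt_j: "coeff p i = 0" if "i < j" for i
      using not_less_Least[of i "\<lambda>i. coeff p i \<noteq> 0"] that unfolding j_def by blast
    define q where "q = poly_shift j p"
    have pq: "p = monom 1 j * q"
      by (rule poly_eqI) (use lt_j in \<open>auto simp: q_def coeff_monom_mult coeff_poly_shift\<close>)
    have "{i. coeff p i \<noteq> 0} = (\<lambda>i. i + j) ` {i. coeff q i \<noteq> 0}"
    proof (intro equalityI subsetI)
      fix i assume i: "i \<in> {i. coeff p i \<noteq> 0}"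
      then have "j \<le> i" using lt_j by (meson mem_Collect_eq not_le)
      then show "i \<in> (\<lambda>i. i + j) ` {i. coeff q i \<noteq> 0}"
        using i by (intro image_eqI[of _ _ "i - j"]) (auto simp: q_def coeff_poly_shift)
    qed (auto simp: q_def coeff_poly_shift)
    then have cq: "card {i. coeff q i \<noteq> 0} = N + 1"
      using card by (simp add: card_image)
    have "q \<noteq> 0" using cq by auto
    then have deg: "degree p = j + degree q" by (simp add: pq degree_mult_eq degree_monom_eq)
    have nn: "\<forall>t\<in>{a..b}. poly q t \<ge> 0"
    proof -
      have *: "poly q t \<ge> 0" if "a < t" "t \<le> b" for t
      proof -
        have "t ^ j > 0" using ab that by simp
        moreover have "t ^ j * poly q t \<ge> 0"
          using less.prems(3)[rule_format, of t] that by (simp add: pq poly_monom)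
        ultimately show ?thesis by (simp add: zero_le_mult_iff)
      qed
      then show ?thesis using poly_nonneg_at_left_end[OF ab(2) *] by (metis atLeastAtMost_iff order_le_less)
    qed
    have "q \<in> sos_cone a b N (d - j)"
    proof (rule sos_cone_by_roots[OF ab finite_poly_support[of q] cq])
      show "{i. coeff q i \<noteq> 0} \<subseteq> {..d - j}"
      proof
        fix i assume "i \<in> {i. coeff q i \<noteq> 0}"
        then have "i \<le> degree q" by (simp add: le_degree)
        then show "i \<in> {..d - j}" using deg less.prems(2) by simp
      qed
      show "0 \<in> {i. coeff q i \<noteq> 0}" using j by (simp add: q_def coeff_poly_shift)
      show "root_poly {#} dvd q" by simp
    qed (use fewer nn in auto)
    from sos_cone_monom_mult[OF this, of j] show ?thesis
      using deg less.prems(2) by (simp flip: pq)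
  qed
qed

text \<open>For \<open>a = b\<close> the weights \<open>t - a\<close> and \<open>a - t\<close> generate all multiples of \<open>t - a\<close>.\<close>

lemma nonneg_at_point_in_sos_cone:
  fixes p :: "real poly"
  assumes "poly p a \<ge> 0" "degree p \<le> d"
  shows "p \<in> sos_cone a a N d"
proof -
  obtain r where r: "p = [:poly p a:] + [:- a, 1:] * r"
  proof -
    have "[:- a, 1:] dvd p - [:poly p a:]" by (simp flip: poly_eq_0_iff_dvd)
    then obtain r where "p - [:poly p a:] = [:- a, 1:] * r" by (elim dvdE)
    then show ?thesis by (intro that[of r]) (metis add.commute diff_add_cancel)
  qed
  have const: "[:poly p a:] \<in> sos_cone a a N d"
    using sos_cone_smult[OF sos_cone.gen[of 1 a a 1 N 0 d], of "poly p a"] assms(1)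
    by (simp add: weights_def)
  show ?thesis
  proof (cases "r = 0")
    case True
    then show ?thesis using const r by simp
  next
    case False
    have dr: "degree r + 1 \<le> d"
    proof -
      have "degree ([:- a, 1:] * r) = degree (p - [:poly p a:])" using r by (metis add_diff_cancel_left')
      also have "\<dots> \<le> d" using assms(2) by (intro degree_diff_le) auto
      finally show ?thesis using False by (subst (asm) degree_mult_eq) auto
    qed
    have "[:- a, 1:] * r = (\<Sum>i\<le>degree r. [:- a, 1:] * monom (coeff r i) i)"
      by (subst poly_as_sum_of_monoms[of r, symmetric]) (simp only: sum_distrib_left)
    also have "\<dots> \<in> sos_cone a a N d"
    proof (rule sos_cone_sum)
      fix i assume i: "i \<in> {..degree r}"
      have w: "\<epsilon> = 1 \<or> \<epsilon> = - 1 \<Longrightarrow> Polynomial.smult \<epsilon> [:- a, 1:] \<in> weights a a" for \<epsilon> :: real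
        by (auto simp: weights_def)
      \<comment> \<open>The sign of \<open>c\<close> selects the weight, and
        \<open>\<bar>c\<bar>\<close> is a nonnegative scalar.\<close>
      have "Polynomial.smult \<bar>c\<bar> (monom 1 i * Polynomial.smult (sgn c) [:- a, 1:] * 1\<^sup>2) \<in> sos_cone a a N d"
        if "c \<noteq> 0" for c :: real
        using i dr that by (intro sos_cone_smult sos_cone.gen w) (auto simp: sgn_if)
      moreover have "Polynomial.smult \<bar>c\<bar> (monom 1 i * Polynomial.smult (sgn c) [:- a, 1:] * 1\<^sup>2)
          = [:- a, 1:] * monom c i" for c :: real
      proof -
        have "Polynomial.smult \<bar>c\<bar> (monom 1 i * Polynomial.smult (sgn c) W * 1\<^sup>2)
            = W * Polynomial.smult (\<bar>c\<bar> * sgn c) (monom 1 i)" for W :: "real poly"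
          by (simp add: mult.commute)
        then show ?thesis by (simp only: abs_mult_sgn smult_monom mult_1_right)
      qed
      ultimately show "[:- a, 1:] * monom (coeff r i) i \<in> sos_cone a a N d"
        by (metis monom_eq_0 mult_zero_right sos_cone.zero)
    qed
    finally show ?thesis using sos_cone.add[OF const] r by metis
  qed
qed

subsection \<open>Moment sequences\<close>

definition riesz :: "nat \<Rightarrow> (nat \<Rightarrow> real) \<Rightarrow> real poly \<Rightarrow> real" where
  "riesz d y p = (\<Sum>i\<le>d. coeff p i * y i)"

lemma riesz_0 [simp]: "riesz d y 0 = 0"
  and riesz_add: "riesz d y (p + q) = riesz d y p + riesz d y q"
  and riesz_smult: "riesz d y (Polynomial.smult c p) = c * riesz d y p"
  by (simp_all add: riesz_def sum.distrib sum_distrib_left algebra_simps)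

lemma riesz_sum: "riesz d y (sum f A) = (\<Sum>i\<in>A. riesz d y (f i))"
  by (induction A rule: infinite_finite_induct) (simp_all add: riesz_add)

lemma riesz_lincomb: "riesz d (\<lambda>i. c * y i + c' * z i) p = c * riesz d y p + c' * riesz d z p"
  by (simp add: riesz_def sum.distrib sum_distrib_left algebra_simps)

lemma riesz_cong: "(\<And>i. i \<le> d \<Longrightarrow> y i = z i) \<Longrightarrow> riesz d y p = riesz d z p"
  by (simp add: riesz_def)

lemma riesz_powers:
  assumes "degree p \<le> d" shows "riesz d (\<lambda>i. c * t ^ i) p = c * poly p t"
proof -
  have "poly p t = poly (\<Sum>i\<le>d. monom (coeff p i) i) t"
    using poly_as_sum_of_monoms'[OF assms] by simp
  then show ?thesis by (simp add: riesz_def poly_sum poly_monom sum_distrib_left mult_ac)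
qed

lemma tendsto_riesz:
  "(\<And>i. i \<le> d \<Longrightarrow> (\<lambda>n. y n i) \<longlonglongrightarrow> z i) \<Longrightarrow> (\<lambda>n. riesz d (y n) p) \<longlonglongrightarrow> riesz d z p"
  unfolding riesz_def by (intro tendsto_intros) auto

text \<open>The coefficients of the squared polynomial become the vector of a quadratic form with a
  localizing Hankel matrix; this translates between weighted squares and matrix
  inequalities.\<close>

lemma riesz_square:
  "riesz d y (monom 1 i * w * (\<Sum>j\<le>e. monom (v j) j)\<^sup>2)
    = (\<Sum>j\<le>e. \<Sum>k\<le>e. v j * v k * riesz d y (monom 1 (i + j + k) * w))"
proof -
  have "monom 1 i * w * (\<Sum>j\<le>e. monom (v j) j)\<^sup>2
      = (\<Sum>j\<le>e. \<Sum>k\<le>e. monom 1 i * w * (monom (v j) j * monom (v k) k))"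
    unfolding power2_eq_square sum_product by (simp only: sum_distrib_left)
  also have "\<dots> = (\<Sum>j\<le>e. \<Sum>k\<le>e. Polynomial.smult (v j * v k) (monom 1 (i + j + k) * w))"
  proof (intro sum.cong refl)
    fix j k
    have "monom (v j) j * monom (v k) k = Polynomial.smult (v j * v k) (monom 1 (j + k))"
      by (simp add: mult_monom smult_monom)
    moreover have "monom 1 i * monom 1 (j + k) = monom (1 :: real) (i + j + k)"
      by (simp add: mult_monom add.assoc)
    moreover have "A * w * Polynomial.smult c M = Polynomial.smult c (A * M * w)" for A M c
      by (simp add: mult_ac)
    ultimately show "monom 1 i * w * (monom (v j) j * monom (v k) k)
        = Polynomial.smult (v j * v k) (monom 1 (i + j + k) * w)"
      by (simp only:)
  qed
  finally show ?thesis by (simp add: riesz_sum riesz_smult)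
qed

text \<open>The dual cone of \<open>sos_cone\<close>, stated through quadratic forms: each triple
  \<open>(w, i, e)\<close> contributes a Hankel matrix of size \<open>e + 1\<close>.\<close>

definition moment_cone :: "real \<Rightarrow> real \<Rightarrow> nat \<Rightarrow> nat \<Rightarrow> (nat \<Rightarrow> real) set" where
  "moment_cone a b N d = {y. \<forall>w\<in>weights a b. \<forall>i e. e \<le> N div 2 \<longrightarrow> i + degree w + 2 * e \<le> d \<longrightarrow>
     (\<forall>v. 0 \<le> (\<Sum>j\<le>e. \<Sum>k\<le>e. v j * v k * riesz d y (monom 1 (i + j + k) * w)))}"

lemma riesz_nonneg_of_moment_cone:
  assumes "p \<in> sos_cone a b N d" "y \<in> moment_cone a b N d"
  shows "riesz d y p \<ge> 0"
  using assms(1)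
proof induction
  case (gen w s i)
  have "0 \<le> riesz d y (monom 1 i * w * (\<Sum>j\<le>degree s. monom (coeff s j) j)\<^sup>2)"
    using gen assms(2) unfolding riesz_square moment_cone_def by blast
  then show ?case by (simp only: poly_as_sum_of_monoms)
qed (auto simp: riesz_add)

text \<open>Point evaluations are nonnegative on weighted squares; \<open>0 \<le> a\<close> takes
  care of the factor \<open>monom 1 i\<close>. The scalar \<open>c\<close> is there for the
  substitution by reciprocals, which introduces a power of \<open>\<tau>\<close>.\<close>

lemma powers_in_moment_cone:
  assumes "0 \<le> a" "t \<in> {a..b}" "c \<ge> 0"
  shows "(\<lambda>i. c * t ^ i) \<in> moment_cone a b N d"
  unfolding moment_cone_def
proof (clarify, unfold riesz_square[symmetric])
  fix w i e v assume w: "w \<in> weights a b" and d: "i + degree w + 2 * e \<le> d"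
  define s :: "real poly" where "s = (\<Sum>j\<le>e. monom (v j) j)"
  have "degree s \<le> e" unfolding s_def
    by (intro degree_sum_le) (auto intro: order.trans[OF degree_monom_le])
  have "degree (monom 1 i * w * s\<^sup>2) \<le> degree (monom (1 :: real) i) + degree w + degree (s\<^sup>2)"
    by (rule order.trans[OF degree_mult_le add_right_mono[OF degree_mult_le]])
  also have "degree (s\<^sup>2) \<le> 2 * degree s"
    using degree_power_le[of s 2] by (simp add: mult.commute)
  finally have "degree (monom 1 i * w * s\<^sup>2) \<le> d"
    using \<open>degree s \<le> e\<close> d degree_monom_le[of "1 :: real" i] by linarith
  then have "riesz d (\<lambda>i. c * t ^ i) (monom 1 i * w * s\<^sup>2) = c * poly (monom 1 i * w * s\<^sup>2) t"
    by (rule riesz_powers)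
  moreover have "poly (monom 1 i) t * poly w t \<ge> 0"
    using assms weights_nonneg[OF w assms(2)] by (simp add: poly_monom)
  ultimately show "0 \<le> riesz d (\<lambda>i. c * t ^ i) (monom 1 i * w * (\<Sum>j\<le>e. monom (v j) j)\<^sup>2)"
    using assms(3) by (simp add: s_def)
qed

lemma moment_cone_cong:
  assumes "y \<in> moment_cone a b N d" "\<And>i. i \<le> d \<Longrightarrow> z i = y i"
  shows "z \<in> moment_cone a b N d"
  using assms(1) riesz_cong[of d z y, OF assms(2)] by (simp add: moment_cone_def)

lemma moment_cone_lincomb:
  assumes "y \<in> moment_cone a b N d" "z \<in> moment_cone a b N d" "c \<ge> 0" "c' \<ge> 0"
  shows "(\<lambda>i. c * y i + c' * z i) \<in> moment_cone a b N d"
  using assms unfolding moment_cone_def riesz_square[symmetric]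
  by (simp add: riesz_lincomb)

lemma moment_cone_closed:
  assumes "\<And>n. y n \<in> moment_cone a b N d" "\<And>i. i \<le> d \<Longrightarrow> (\<lambda>n. y n i) \<longlonglongrightarrow> z i"
  shows "z \<in> moment_cone a b N d"
  unfolding moment_cone_def
proof (clarify, unfold riesz_square[symmetric])
  fix w i e v assume *: "w \<in> weights a b" "e \<le> N div 2" "i + degree w + 2 * e \<le> d"
  show "0 \<le> riesz d z (monom 1 i * w * (\<Sum>j\<le>e. monom (v j) j)\<^sup>2)"
  proof (rule LIMSEQ_le_const[OF tendsto_riesz[OF assms(2)]])
    show "\<exists>M. \<forall>n\<ge>M. 0 \<le> riesz d (y n) (monom 1 i * w * (\<Sum>j\<le>e. monom (v j) j)\<^sup>2)"
      using assms(1) * unfolding moment_cone_def riesz_square[symmetric] by blast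
  qed
qed

section \<open>Reflected intervals and half-lines\<close>

text \<open>A piece \<open>(\<sigma>, \<rho>, a, b)\<close> encodes the interval \<open>\<sigma> * [a, b]\<close>, or, if \<open>\<rho>\<close> holds, the half-line
  of all \<open>\<sigma> / \<tau>\<close> with \<open>0 < \<tau> \<le> b\<close>. The substitution \<open>t = \<sigma> / \<tau>\<close> reverses moment sequences, up to
  the positive factor \<open>\<tau> ^ d\<close>.\<close>

type_synonym piece = "real \<times> bool \<times> real \<times> real"

fun valid_piece :: "piece \<Rightarrow> bool" where
  "valid_piece (\<sigma>, \<rho>, a, b) \<longleftrightarrow> (\<sigma> = 1 \<or> \<sigma> = - 1) \<and> 0 \<le> a \<and> a \<le> b \<and> (\<rho> \<longrightarrow> a = 0 \<and> 0 < b)"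

fun piece_set :: "piece \<Rightarrow> real set" where
  "piece_set (\<sigma>, \<rho>, a, b) =
     (if \<rho> then (\<lambda>\<tau>. \<sigma> / \<tau>) ` ({a..b} \<inter> {0<..}) else (\<lambda>\<tau>. \<sigma> * \<tau>) ` {a..b})"

definition flip_index :: "bool \<Rightarrow> nat \<Rightarrow> nat \<Rightarrow> nat" where
  "flip_index \<rho> d i = (if \<rho> then d - i else i)"

text \<open>The sequence is pulled back to the variable \<open>\<tau>\<close> in
  \<open>[a, b]\<close>. With \<open>\<rho>\<close>, the value \<open>\<tau> = 0\<close> corresponds
  to mass at infinity, visible only in the entry of index \<open>d\<close>; this keeps the cone of a
  half-line closed.\<close>

fun piece_cone :: "nat \<Rightarrow> nat \<Rightarrow> piece \<Rightarrow> (nat \<Rightarrow> real) set" where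
  "piece_cone N d (\<sigma>, \<rho>, a, b) =
     {y. (\<lambda>i. \<sigma> ^ flip_index \<rho> d i * y (flip_index \<rho> d i)) \<in> moment_cone a b N d}"

lemma flip_index_le: "i \<le> d \<Longrightarrow> flip_index \<rho> d i \<le> d"
  and flip_index_flip_index: "i \<le> d \<Longrightarrow> flip_index \<rho> d (flip_index \<rho> d i) = i"
  by (auto simp: flip_index_def)

lemma sum_flip_index: "(\<Sum>i\<le>d. f (flip_index \<rho> d i)) = (\<Sum>i\<le>d. f i)"
  by (rule sum.reindex_bij_witness[of _ "flip_index \<rho> d" "flip_index \<rho> d"])
    (auto simp: flip_index_le flip_index_flip_index)

lemma piece_cone_lincomb:
  assumes "y \<in> piece_cone N d P" "z \<in> piece_cone N d P" "c \<ge> 0" "c' \<ge> 0"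
  shows "(\<lambda>i. c * y i + c' * z i) \<in> piece_cone N d P"
proof (cases P rule: piece_set.cases)
  case (1 \<sigma> \<rho> a b)
  let ?j = "flip_index \<rho> d"
  have "(\<lambda>i. c * (\<sigma> ^ ?j i * y (?j i)) + c' * (\<sigma> ^ ?j i * z (?j i))) \<in> moment_cone a b N d"
    using assms 1 by (intro moment_cone_lincomb) auto
  then show ?thesis using 1 by (simp add: algebra_simps)
qed

lemma piece_cone_closed:
  assumes "\<And>n. y n \<in> piece_cone N d P" "\<And>i. i \<le> d \<Longrightarrow> (\<lambda>n. y n i) \<longlonglongrightarrow> z i"
  shows "z \<in> piece_cone N d P"
proof (cases P rule: piece_set.cases)
  case (1 \<sigma> \<rho> a b)
  let ?j = "flip_index \<rho> d"
  have "(\<lambda>i. \<sigma> ^ ?j i * z (?j i)) \<in> moment_cone a b N d"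
  proof (rule moment_cone_closed)
    show "(\<lambda>i. \<sigma> ^ ?j i * y n (?j i)) \<in> moment_cone a b N d" for n using assms(1)[of n] 1 by simp
    show "(\<lambda>n. \<sigma> ^ ?j i * y n (?j i)) \<longlonglongrightarrow> \<sigma> ^ ?j i * z (?j i)" if "i \<le> d" for i
      using that by (intro tendsto_intros assms(2) flip_index_le)
  qed
  then show ?thesis using 1 by simp
qed

lemma zero_in_piece_cone: "(\<lambda>i. 0) \<in> piece_cone N d P"
  by (cases P rule: piece_set.cases) (simp add: moment_cone_def riesz_def)

lemma powers_in_piece_cone:
  assumes "valid_piece P" "t \<in> piece_set P"
  shows "(\<lambda>i. t ^ i) \<in> piece_cone N d P"
proof (cases P rule: piece_set.cases)
  case (1 \<sigma> \<rho> a b)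
  then have ab: "0 \<le> a" using assms(1) by simp
  have \<sigma>: "\<sigma> * \<sigma> = 1" "\<sigma> \<noteq> 0" using assms(1) 1 by auto
  show ?thesis
  proof (cases \<rho>)
    case False
    then obtain \<tau> where \<tau>: "\<tau> \<in> {a..b}" "t = \<sigma> * \<tau>" using assms(2) 1 by auto
    have "\<sigma> ^ i * t ^ i = 1 * \<tau> ^ i" for i
      using \<sigma> by (simp add: \<tau>(2) flip: power_mult_distrib mult.assoc)
    then have "(\<lambda>i. \<sigma> ^ i * t ^ i) \<in> moment_cone a b N d"
      using powers_in_moment_cone[OF ab \<tau>(1), of 1] by simp
    then show ?thesis using 1 False by (simp add: flip_index_def)
  next
    case True
    then obtain \<tau> where \<tau>: "\<tau> \<in> {a..b}" "0 < \<tau>" "t = \<sigma> / \<tau>" using assms(2) 1 by auto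
    have "\<sigma> ^ (d - i) * t ^ (d - i) = (1 / \<tau> ^ d) * \<tau> ^ i" if "i \<le> d" for i
    proof -
      have "\<sigma> ^ (d - i) * t ^ (d - i) = (1 / \<tau>) ^ (d - i)"
        using \<sigma> by (simp add: \<tau>(3) flip: power_mult_distrib)
      also have "\<dots> = (1 / \<tau> ^ d) * \<tau> ^ i"
        using that \<tau>(2) by (simp add: power_diff power_divide)
      finally show ?thesis .
    qed
    moreover have "(\<lambda>i. (1 / \<tau> ^ d) * \<tau> ^ i) \<in> moment_cone a b N d"
      using \<tau>(2) by (intro powers_in_moment_cone ab \<tau>) auto
    ultimately have "(\<lambda>i. \<sigma> ^ (d - i) * t ^ (d - i)) \<in> moment_cone a b N d"
      by (metis (no_types, lifting) moment_cone_cong)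
    then show ?thesis using 1 True by (simp add: flip_index_def)
  qed
qed

text \<open>The substitution turns \<open>p\<close> into a polynomial \<open>q\<close> on
  \<open>[a, b]\<close> with at most as many monomials and degree at most \<open>d\<close>, to which
  the sparse Positivstellensatz applies.\<close>

lemma riesz_nonneg_of_piece_cone:
  assumes P: "valid_piece P" and y: "y \<in> piece_cone N d P"
    and p: "degree p \<le> d" "card {i. coeff p i \<noteq> 0} \<le> N + 1" "\<And>t. t \<in> piece_set P \<Longrightarrow> poly p t \<ge> 0"
  shows "riesz d y p \<ge> 0"
proof (cases P rule: piece_set.cases)
  case (1 \<sigma> \<rho> a b)
  let ?j = "flip_index \<rho> d"
  have ab: "0 \<le> a" "a \<le> b" and \<rho>: "\<rho> \<Longrightarrow> a = 0 \<and> 0 < b" using P 1 by auto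
  have \<sigma>: "\<sigma> * \<sigma> = 1" "\<sigma> \<noteq> 0" using P 1 by auto
  \<comment> \<open>\<open>q\<close> is \<open>p (\<sigma> * \<tau>)\<close>, or
    \<open>\<tau> ^ d * p (\<sigma> / \<tau>)\<close> in the reversed case.\<close>
  define q where "q = (\<Sum>i\<le>d. monom (\<sigma> ^ ?j i * coeff p (?j i)) i)"
  have coeff_q: "coeff q i = (if i \<le> d then \<sigma> ^ ?j i * coeff p (?j i) else 0)" for i
    by (simp add: q_def coeff_sum)
  have "degree q \<le> d" unfolding q_def
    by (intro degree_sum_le) (auto intro: order.trans[OF degree_monom_le])
  have "{i. coeff q i \<noteq> 0} \<subseteq> ?j ` {i. coeff p i \<noteq> 0}"
  proof
    fix i assume "i \<in> {i. coeff q i \<noteq> 0}"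
    then have "i \<le> d" "coeff p (?j i) \<noteq> 0" by (auto simp: coeff_q split: if_splits)
    then show "i \<in> ?j ` {i. coeff p i \<noteq> 0}"
      by (intro image_eqI[of _ _ "?j i"]) (simp_all add: flip_index_flip_index)
  qed
  then have "card {i. coeff q i \<noteq> 0} \<le> card (?j ` {i. coeff p i \<noteq> 0})"
    by (intro card_mono finite_imageI finite_poly_support)
  also have "\<dots> \<le> card {i. coeff p i \<noteq> 0}"
    by (intro card_image_le finite_poly_support)
  finally have card_q: "card {i. coeff q i \<noteq> 0} \<le> N + 1" using p(2) by simp
  have poly_p: "poly p u = (\<Sum>i\<le>d. coeff p i * u ^ i)" for u
    using riesz_powers[OF p(1), of 1 u] by (simp add: riesz_def)
  have poly_q: "poly q \<tau> = (\<Sum>i\<le>d. \<sigma> ^ i * coeff p i * \<tau> ^ ?j i)" for \<tau>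
  proof -
    have "poly q \<tau> = (\<Sum>i\<le>d. \<sigma> ^ ?j i * coeff p (?j i) * \<tau> ^ ?j (?j i))"
      by (simp add: q_def poly_sum poly_monom flip_index_flip_index)
    then show ?thesis by (simp only: sum_flip_index[of "\<lambda>i. \<sigma> ^ i * coeff p i * \<tau> ^ ?j i"])
  qed
  have nn: "\<forall>\<tau>\<in>{a..b}. poly q \<tau> \<ge> 0"
  proof (cases \<rho>)
    case False
    show ?thesis
    proof
      fix \<tau> assume "\<tau> \<in> {a..b}"
      then have "poly p (\<sigma> * \<tau>) \<ge> 0" using 1 False by (intro p(3)) auto
      moreover have "poly p (\<sigma> * \<tau>) = poly q \<tau>"
        using False unfolding poly_p poly_q by (simp add: flip_index_def power_mult_distrib mult_ac)
      ultimately show "poly q \<tau> \<ge> 0" by simp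
    qed
  next
    case True
    \<comment> \<open>The value \<open>\<tau> = 0\<close> has no counterpart in the half-line and is
      reached by continuity.\<close>
    have *: "poly q \<tau> \<ge> 0" if \<tau>: "a < \<tau>" "\<tau> \<le> b" for \<tau>
    proof -
      have "\<tau> > 0" using \<tau> ab by simp
      have "poly p (\<sigma> / \<tau>) \<ge> 0" using 1 True \<tau> ab by (intro p(3)) auto
      moreover have "poly q \<tau> = \<tau> ^ d * poly p (\<sigma> / \<tau>)"
        unfolding poly_p poly_q sum_distrib_left
        using True \<open>\<tau> > 0\<close> by (intro sum.cong) (auto simp: flip_index_def power_diff power_divide)
      ultimately show ?thesis using \<open>\<tau> > 0\<close> by simp
    qed
    then show ?thesis using \<rho>[OF True] poly_nonneg_at_left_end[of a b q]
      by (metis atLeastAtMost_iff order_le_less)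
  qed
  have "q \<in> sos_cone a b N d"
  proof (cases "a = b")
    case True
    then show ?thesis using nonneg_at_point_in_sos_cone[of q b d N] nn \<open>degree q \<le> d\<close> by simp
  next
    case False
    then show ?thesis
      using sparse_nonneg_in_sos_cone[OF ab(1) _ card_q \<open>degree q \<le> d\<close> nn] ab by simp
  qed
  moreover have "(\<lambda>i. \<sigma> ^ ?j i * y (?j i)) \<in> moment_cone a b N d" using y 1 by simp
  ultimately have "riesz d (\<lambda>i. \<sigma> ^ ?j i * y (?j i)) q \<ge> 0" by (rule riesz_nonneg_of_moment_cone)
  also have "riesz d (\<lambda>i. \<sigma> ^ ?j i * y (?j i)) q = (\<Sum>i\<le>d. (\<lambda>k. (\<sigma> * \<sigma>) ^ k * coeff p k * y k) (?j i))"
    unfolding riesz_def by (intro sum.cong) (auto simp: coeff_q power_mult_distrib)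
  also have "\<dots> = riesz d y p"
    unfolding sum_flip_index[of "\<lambda>k. (\<sigma> * \<sigma>) ^ k * coeff p k * y k"] by (simp add: riesz_def \<sigma>)
  finally show ?thesis .
qed

subsection \<open>Decomposition of semialgebraic sets\<close>

text \<open>Constancy off a finite set is convenient because it passes to complements with the same
  \<open>Z\<close> and to unions with the union of the sets. For a nonzero polynomial,
  \<open>Z\<close> is its root set, by the intermediate value theorem.\<close>

lemma semialgebraic_finite_boundary:
  assumes "semialgebraic I"
  shows "\<exists>Z. finite Z \<and> (\<forall>s t. s \<le> t \<longrightarrow> {s..t} \<inter> Z = {} \<longrightarrow> (s \<in> I \<longleftrightarrow> t \<in> I))"
  using assms
proof induction
  case (pos p)
  show ?case
  proof (cases "p = 0")
    case False
    have "poly p s > 0 \<longleftrightarrow> poly p t > 0" if "s \<le> t" "{s..t} \<inter> {x. poly p x = 0} = {}" for s t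
    proof -
      have nz: "\<forall>x. s \<le> x \<and> x \<le> t \<longrightarrow> poly p x \<noteq> 0" using that by auto
      then have "\<not> (poly p s < 0 \<and> 0 < poly p t)" "\<not> (poly p t < 0 \<and> 0 < poly p s)"
        using poly_IVT_pos[of s t p] poly_IVT_neg[of s t p] that(1)
        by (metis less_eq_real_def order_less_asym)+
      moreover have "poly p s \<noteq> 0" "poly p t \<noteq> 0" using nz that(1) by auto
      ultimately show ?thesis by linarith
    qed
    then show ?thesis using poly_roots_finite[OF False]
      by (intro exI[of _ "{x. poly p x = 0}"]) auto
  qed auto
next
  case (compl A)
  then show ?case by auto
next
  case (union A B)
  then obtain Z Z' where "finite Z" "finite Z'"
    and Z: "\<And>s t. s \<le> t \<Longrightarrow> {s..t} \<inter> Z = {} \<Longrightarrow> (s \<in> A) = (t \<in> A)"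
    and Z': "\<And>s t. s \<le> t \<Longrightarrow> {s..t} \<inter> Z' = {} \<Longrightarrow> (s \<in> B) = (t \<in> B)" by blast
  show ?case
  proof (intro exI[of _ "Z \<union> Z'"] conjI allI impI)
    fix s t assume st: "s \<le> t" "{s..t} \<inter> (Z \<union> Z') = {}"
    then have "{s..t} \<inter> Z = {}" "{s..t} \<inter> Z' = {}" by blast+
    then show "s \<in> A \<union> B \<longleftrightarrow> t \<in> A \<union> B" using Z Z' st(1) by blast
  qed (use \<open>finite Z\<close> \<open>finite Z'\<close> in simp)
qed

text \<open>The nearest points of \<open>Z\<close> on either side of \<open>t\<close> bound an
  interval on which membership in \<open>I\<close> is constant. Having \<open>0\<close> in
  \<open>Z\<close> keeps the left end nonnegative; \<open>1\<close> in \<open>Z\<close> makes it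
  positive when nothing lies to the right, so that it can be inverted. The restriction on the
  endpoints leaves finitely many candidates.\<close>

lemma piece_around_pos:
  fixes Z I :: "real set"
  assumes Z: "finite Z" "0 \<in> Z" "1 \<in> Z"
    and const: "\<And>s t. s \<le> t \<Longrightarrow> {s..t} \<inter> Z = {} \<Longrightarrow> (s \<in> I \<longleftrightarrow> t \<in> I)"
    and t: "t \<in> I" "0 < t"
  shows "\<exists>\<rho> a b. a \<in> Z \<union> inverse ` Z \<and> b \<in> Z \<union> inverse ` Z \<and> valid_piece (1, \<rho>, a, b) \<and>
    t \<in> piece_set (1, \<rho>, a, b) \<and> piece_set (1, \<rho>, a, b) \<subseteq> closure I"
proof (cases "t \<in> Z")
  case True
  then show ?thesis using t closure_subset[of I]
    by (intro exI[of _ False] exI[of _ t]) auto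
next
  case False
  define L where "L = {z \<in> Z. z < t}"
  define l where "l = Max L"
  have L: "finite L" "0 \<in> L" using Z t by (auto simp: L_def)
  have l: "l \<in> Z" "l < t" "0 \<le> l"
    using Max_in[OF L(1)] Max_ge[OF L] L(2) unfolding l_def L_def by auto
  have lmax: "z \<le> l" if "z \<in> Z" "z < t" for z
    using Max_ge[OF L(1), of z] that by (auto simp: l_def L_def)
  define U where "U = {z \<in> Z. t < z}"
  have in_I: "s \<in> I" if "l < s" "\<And>z. z \<in> U \<Longrightarrow> s < z" for s
  proof -
    have "z \<notin> Z" if "min s t \<le> z" "z \<le> max s t" for z
    proof
      assume "z \<in> Z"
      then consider "z < t" | "z \<in> U" using False by (force simp: U_def)
      then show False
      proof cases
        case 1
        then show ?thesis using lmax[OF \<open>z \<in> Z\<close>] \<open>l < s\<close> l that by linarith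
      next
        case 2
        then have "s < z" "t < z" using \<open>\<And>z. z \<in> U \<Longrightarrow> s < z\<close> by (auto simp: U_def)
        then show ?thesis using that by linarith
      qed
    qed
    then have "{min s t..max s t} \<inter> Z = {}" by auto
    then have "min s t \<in> I \<longleftrightarrow> max s t \<in> I" by (intro const) auto
    then show ?thesis using t by (auto simp: min_def max_def split: if_splits)
  qed
  show ?thesis
  proof (cases "U = {}")
    case False
    define u where "u = Min U"
    have "finite U" using Z by (simp add: U_def)
    then have u: "u \<in> Z" "t < u" "\<And>z. z \<in> U \<Longrightarrow> u \<le> z"
      using Min_in[OF _ False] False by (auto simp: u_def U_def)
    have "{l<..<u} \<subseteq> I" using in_I u(3) by fastforce
    then have "{l..u} \<subseteq> closure I"
      using closure_mono[of "{l<..<u}" I] l u by simp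
    then show ?thesis using l u
      by (intro exI[of _ False] exI[of _ l] exI[of _ u]) auto
  next
    case True
    then have "1 < t" using Z \<open>t \<notin> Z\<close> by (cases "1 = t") (auto simp: U_def not_less)
    then have "1 \<le> l" using lmax Z by auto
    have "{l<..} \<subseteq> I" using in_I True by auto
    then have *: "{l..} \<subseteq> closure I"
      using closure_mono[of "{l<..}" I] by simp
    have "1 / \<tau> \<in> {l..}" if "0 < \<tau>" "\<tau> \<le> inverse l" for \<tau>
    proof -
      have "l * \<tau> \<le> l * inverse l" using that \<open>1 \<le> l\<close> by (intro mult_left_mono) auto
      then show ?thesis using that \<open>1 \<le> l\<close> by (simp add: field_simps)
    qed
    then have "piece_set (1, True, 0, inverse l) \<subseteq> closure I" using * by auto
    moreover have "t \<in> piece_set (1, True, 0, inverse l)"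
      using l \<open>1 \<le> l\<close> by (auto intro!: image_eqI[of _ _ "1 / t"] simp: field_simps)
    ultimately show ?thesis using l Z \<open>1 \<le> l\<close>
      by (intro exI[of _ True] exI[of _ 0] exI[of _ "inverse l"]) auto
  qed
qed

lemma semialgebraic_pieces:
  assumes "semialgebraic I"
  shows "\<exists>PS. finite PS \<and> (\<forall>P\<in>PS. valid_piece P \<and> piece_set P \<subseteq> closure I) \<and> I \<subseteq> \<Union> (piece_set ` PS)"
proof -
  obtain Z0 where Z0: "finite Z0"
    "\<And>s t. s \<le> t \<Longrightarrow> {s..t} \<inter> Z0 = {} \<Longrightarrow> (s \<in> I \<longleftrightarrow> t \<in> I)"
    using semialgebraic_finite_boundary[OF assms] by auto
  \<comment> \<open>Symmetry under negation lets the same endpoints serve the reflected set for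
    negative \<open>t\<close>.\<close>
  define Z where "Z = Z0 \<union> uminus ` Z0 \<union> {0, 1, - 1}"
  have Z: "finite Z" "0 \<in> Z" "1 \<in> Z" "uminus ` Z = Z"
    using Z0(1) by (auto simp: Z_def image_Un image_image)
  have const: "s \<in> I \<longleftrightarrow> t \<in> I" if "s \<le> t" "{s..t} \<inter> Z = {}" for s t
    using that by (intro Z0(2)) (auto simp: Z_def)
  define C where "C = Z \<union> inverse ` Z"
  define PS where "PS = {P \<in> {1, - 1} \<times> UNIV \<times> C \<times> C. valid_piece P \<and> piece_set P \<subseteq> closure I}"
  have "PS \<subseteq> {1, - 1} \<times> UNIV \<times> C \<times> C" by (auto simp: PS_def)
  moreover have "finite C" using Z by (simp add: C_def)
  ultimately have "finite PS" by (auto intro: finite_subset)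
  moreover have "\<exists>P\<in>PS. t \<in> piece_set P" if t: "t \<in> I" for t
  proof -
    consider "t = 0" | "t > 0" | "t < 0" by linarith
    then show ?thesis
    proof cases
      case 1
      then show ?thesis using t Z closure_subset[of I]
        by (intro bexI[of _ "(1, False, 0, 0)"]) (auto simp: PS_def C_def)
    next
      case 2
      obtain \<rho> a b where "a \<in> C" "b \<in> C" "valid_piece (1, \<rho>, a, b)"
        "t \<in> piece_set (1, \<rho>, a, b)" "piece_set (1, \<rho>, a, b) \<subseteq> closure I"
        using piece_around_pos[OF Z(1-3) const t 2] unfolding C_def by blast
      then show ?thesis by (intro bexI[of _ "(1, \<rho>, a, b)"]) (auto simp: PS_def)
    next
      case 3
      have const': "s \<in> uminus ` I \<longleftrightarrow> t \<in> uminus ` I" if "s \<le> t" "{s..t} \<inter> Z = {}" for s t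
      proof -
        have "z \<notin> {- t..- s}" if "z \<in> Z" for z
        proof
          assume "z \<in> {- t..- s}"
          then have "- z \<in> {s..t}" by auto
          moreover have "- z \<in> Z" using that Z(4) by (metis imageI)
          ultimately show False using \<open>{s..t} \<inter> Z = {}\<close> by auto
        qed
        then have "- t \<in> I \<longleftrightarrow> - s \<in> I" using that(1) by (intro const) auto
        moreover have "u \<in> uminus ` I \<longleftrightarrow> - u \<in> I" for u
          by (auto intro!: image_eqI[of u uminus "- u"])
        ultimately show ?thesis by simp
      qed
      have "- t \<in> uminus ` I" "0 < - t" using t 3 by auto
      from piece_around_pos[OF Z(1-3) const' this] obtain \<rho> a b where
        ab: "a \<in> C" "b \<in> C" "valid_piece (1, \<rho>, a, b)"
        "- t \<in> piece_set (1, \<rho>, a, b)" "piece_set (1, \<rho>, a, b) \<subseteq> closure (uminus ` I)"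
        unfolding C_def by blast
      have eq: "piece_set (- 1, \<rho>, a, b) = uminus ` piece_set (1, \<rho>, a, b)"
        by (auto simp: image_image)
      have "uminus ` closure (uminus ` I) \<subseteq> closure (uminus ` uminus ` I)"
        by (intro closure_bounded_linear_image_subset bounded_linear_minus bounded_linear_ident)
      then have "uminus ` closure (uminus ` I) \<subseteq> closure I"
        by (simp add: image_image)
      then have "piece_set (- 1, \<rho>, a, b) \<subseteq> closure I"
        using ab(5) unfolding eq by blast
      moreover have "t \<in> piece_set (- 1, \<rho>, a, b)"
        using ab(4) unfolding eq by force
      ultimately show ?thesis using ab
        by (intro bexI[of _ "(- 1, \<rho>, a, b)"]) (auto simp: PS_def simp del: piece_set.simps)
    qed
  qed
  ultimately show ?thesis by (intro exI[of _ PS]) (auto simp: PS_def)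
qed

subsection \<open>Linear matrix inequalities\<close>

lemma affine_linear_const: "affine_linear n (\<lambda>x y. c)"
  unfolding affine_linear_def
  by (intro exI[of _ c] exI[of _ 0] bexI[of _ "0\<^sub>v n"]) auto

lemma affine_linear_add:
  assumes "affine_linear n f" "affine_linear n g"
  shows "affine_linear n (\<lambda>x y. f x y + g x y)"
proof -
  obtain c a b where f: "b \<in> carrier_vec n"
    "\<And>x y. y \<in> carrier_vec n \<Longrightarrow> f x y = c + inner a x + scalar_prod b y"
    using assms(1) unfolding affine_linear_def by blast
  obtain c' a' b' where g: "b' \<in> carrier_vec n"
    "\<And>x y. y \<in> carrier_vec n \<Longrightarrow> g x y = c' + inner a' x + scalar_prod b' y"
    using assms(2) unfolding affine_linear_def by blast
  show ?thesis unfolding affine_linear_def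
    by (intro exI[of _ "c + c'"] exI[of _ "a + a'"] bexI[of _ "b + b'"] allI ballI)
      (use f g in \<open>auto simp: inner_add_left add_scalar_prod_distrib[where n = n]\<close>)
qed

lemma affine_linear_scale:
  assumes "affine_linear n f"
  shows "affine_linear n (\<lambda>x y. k * f x y)"
proof -
  obtain c a b where f: "b \<in> carrier_vec n"
    "\<And>x y. y \<in> carrier_vec n \<Longrightarrow> f x y = c + inner a x + scalar_prod b y"
    using assms(1) unfolding affine_linear_def by blast
  show ?thesis unfolding affine_linear_def
    by (intro exI[of _ "k * c"] exI[of _ "k *\<^sub>R a"] bexI[of _ "k \<cdot>\<^sub>v b"] allI ballI)
      (use f in \<open>auto simp: distrib_left\<close>)
qed

lemma affine_linear_diff:
  "affine_linear n f \<Longrightarrow> affine_linear n g \<Longrightarrow> affine_linear n (\<lambda>x y. f x y - g x y)"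
  using affine_linear_add[of n f "\<lambda>x y. (- 1) * g x y"] affine_linear_scale[of n g "- 1"] by simp

lemma affine_linear_sum:
  "(\<And>i. i \<in> A \<Longrightarrow> affine_linear n (f i)) \<Longrightarrow> affine_linear n (\<lambda>x y. \<Sum>i\<in>A. f i x y)"
  by (induction A rule: infinite_finite_induct) (auto intro: affine_linear_const affine_linear_add)

lemma affine_linear_point: "affine_linear n (\<lambda>x y. Finite_Cartesian_Product.vec_nth x i)"
  unfolding affine_linear_def
  by (intro exI[of _ 0] exI[of _ "axis i 1"] bexI[of _ "0\<^sub>v n"]) (auto simp: inner_axis')

lemma affine_linear_lift: "j < n \<Longrightarrow> affine_linear n (\<lambda>x y. vec_index y j)"
  unfolding affine_linear_def
  by (intro exI[of _ 0] bexI[of _ "unit_vec n j"]) auto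

lemma psd_mat_iff:
  assumes "\<And>i j. A i j = A j i"
  shows "psd_mat (Matrix.mat e e (\<lambda>(i, j). A i j))
    \<longleftrightarrow> (\<forall>v. 0 \<le> (\<Sum>i<e. \<Sum>j<e. v i * v j * A i j))"
proof -
  have sym: "symmetric_mat (Matrix.mat e e (\<lambda>(i, j). A i j))"
    unfolding symmetric_mat_def using assms by (intro eq_matI) auto
  have quad: "scalar_prod v (Matrix.mat e e (\<lambda>(i, j). A i j) *\<^sub>v v)
      = (\<Sum>i<e. \<Sum>j<e. vec_index v i * vec_index v j * A i j)" if "v \<in> carrier_vec e" for v
    using that by (auto simp: scalar_prod_def sum_distrib_left mult_ac lessThan_atLeast0 intro!: sum.cong)
  show ?thesis
  proof
    assume *: "psd_mat (Matrix.mat e e (\<lambda>(i, j). A i j))"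
    show "\<forall>v. 0 \<le> (\<Sum>i<e. \<Sum>j<e. v i * v j * A i j)"
    proof
      fix v
      have "0 \<le> scalar_prod (Matrix.vec e v) (Matrix.mat e e (\<lambda>(i, j). A i j) *\<^sub>v Matrix.vec e v)"
        using * unfolding psd_mat_def by simp
      then show "0 \<le> (\<Sum>i<e. \<Sum>j<e. v i * v j * A i j)" by (subst (asm) quad) auto
    qed
  next
    assume "\<forall>v. 0 \<le> (\<Sum>i<e. \<Sum>j<e. v i * v j * A i j)"
    then show "psd_mat (Matrix.mat e e (\<lambda>(i, j). A i j))"
      unfolding psd_mat_def using sym quad by simp
  qed
qed

text \<open>A system given as a finite set of sizes and entry functions, with quadratic forms over
  functions on \<open>nat\<close>, keeps the carrier-based matrices out of the later proofs.\<close>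

lemma has_lifted_sdrI:
  fixes Q :: "(nat \<times> (nat \<Rightarrow> nat \<Rightarrow> real ^ 'n \<Rightarrow> real Matrix.vec \<Rightarrow> real)) set"
  assumes "finite Q"
    and Q: "\<And>e A. (e, A) \<in> Q \<Longrightarrow> e \<le> d \<and> (\<forall>i<e. \<forall>j<e. affine_linear n (A i j)) \<and> (\<forall>i j. A i j = A j i)"
    and C: "\<And>x. x \<in> C \<longleftrightarrow> (\<exists>y\<in>carrier_vec n. \<forall>(e, A)\<in>Q. \<forall>v. 0 \<le> (\<Sum>i<e. \<Sum>j<e. v i * v j * A i j x y))"
  shows "has_lifted_sdr d C"
proof -
  obtain qs where qs: "set qs = Q" using finite_list[OF assms(1)] by blast
  define M where "M = (\<lambda>k x y. Matrix.mat (fst (qs ! k)) (fst (qs ! k)) (\<lambda>(i, j). snd (qs ! k) i j x y))"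
  have in_Q: "(fst (qs ! k), snd (qs ! k)) \<in> Q" if "k < length qs" for k
    using that qs by auto
  have psd: "psd_mat (M k x y) \<longleftrightarrow>
      (\<forall>v. 0 \<le> (\<Sum>i<fst (qs ! k). \<Sum>j<fst (qs ! k). v i * v j * snd (qs ! k) i j x y))"
    if "k < length qs" for k x y
    unfolding M_def using Q[OF in_Q[OF that]] by (intro psd_mat_iff) metis
  have pencil: "\<exists>e\<le>d. lmi_pencil e n (M k)" if "k < length qs" for k
    unfolding lmi_pencil_def
  proof (intro exI[of _ "fst (qs ! k)"] conjI allI ballI impI)
    show "fst (qs ! k) \<le> d" using Q[OF in_Q[OF that]] by blast
    show "M k x y \<in> carrier_mat (fst (qs ! k)) (fst (qs ! k))" for x y by (simp add: M_def)
    have "snd (qs ! k) i j = snd (qs ! k) j i" for i j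
      using Q[OF in_Q[OF that]] by blast
    then show "symmetric_mat (M k x y)" for x y
      unfolding symmetric_mat_def M_def by (intro eq_matI) auto
    show "affine_linear n (\<lambda>x y. M k x y $$ (i, j))" if "i < fst (qs ! k)" "j < fst (qs ! k)" for i j
      using Q[OF in_Q[OF \<open>k < length qs\<close>]] that by (simp add: M_def)
  qed
  have "x \<in> C \<longleftrightarrow> (\<exists>y\<in>carrier_vec n. \<forall>k<length qs. psd_mat (M k x y))" for x
    unfolding C qs[symmetric] all_set_conv_all_nth using psd by (simp add: case_prod_unfold)
  then show ?thesis unfolding has_lifted_sdr_def using pencil
    by (intro exI[of _ n] exI[of _ "length qs"] exI[of _ M]) auto
qed

lemma quadratic_form_1: "(\<forall>v :: nat \<Rightarrow> real. 0 \<le> (\<Sum>i<(1::nat). \<Sum>j<(1::nat). v i * v j * c)) \<longleftrightarrow> 0 \<le> c"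
proof
  assume "\<forall>v :: nat \<Rightarrow> real. 0 \<le> (\<Sum>i<(1::nat). \<Sum>j<(1::nat). v i * v j * c)"
  from spec[OF this, of "\<lambda>_. 1"] show "0 \<le> c" by simp
qed simp

subsection \<open>The lifted description\<close>

text \<open>The entry of \<open>x\<close> that belongs to the monomial \<open>t ^ e\<close>, with
  \<open>1\<close> for the constant monomial. For a repeated exponent \<open>inv_into\<close>
  selects one index.\<close>

definition coord :: "('n::finite \<Rightarrow> nat) \<Rightarrow> real ^ 'n \<Rightarrow> nat \<Rightarrow> real" where
  "coord m x e = (if e = 0 then 1 else Finite_Cartesian_Product.vec_nth x (inv_into UNIV m e))"

text \<open>The rows \<open>y j\<close> are the (unnormalised) moment sequences of the part of a representing measure
  of \<open>x\<close> carried by the \<open>j\<close>-th piece. Coordinates of \<open>x\<close> whose exponent is not in \<open>D\<close> are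
  unconstrained, except that equal exponents force equal coordinates.\<close>

definition lifts :: "('n::finite \<Rightarrow> nat) \<Rightarrow> nat set \<Rightarrow> nat \<Rightarrow> nat \<Rightarrow> piece list \<Rightarrow> real ^ 'n
    \<Rightarrow> (nat \<Rightarrow> nat \<Rightarrow> real) \<Rightarrow> bool" where
  "lifts m D N d ps x y \<longleftrightarrow>
     (\<forall>i. Finite_Cartesian_Product.vec_nth x i = coord m x (m i)) \<and>
     (\<forall>e\<in>D. (\<Sum>j<length ps. y j e) = coord m x e) \<and>
     (\<forall>j<length ps. y j \<in> piece_cone N d (ps ! j))"

fun piece_forms :: "nat \<Rightarrow> nat \<Rightarrow> piece \<Rightarrow> (nat \<times> (nat \<Rightarrow> nat \<Rightarrow> (nat \<Rightarrow> real) \<Rightarrow> real)) set" where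
  "piece_forms N d (\<sigma>, \<rho>, a, b) =
     (\<lambda>(w, i, e). (Suc e, \<lambda>p q y.
        riesz d (\<lambda>k. \<sigma> ^ flip_index \<rho> d k * y (flip_index \<rho> d k)) (monom 1 (i + p + q) * w))) `
     {(w, i, e). w \<in> weights a b \<and> e \<le> N div 2 \<and> i + degree w + 2 * e \<le> d}"

lemma finite_piece_forms: "finite (piece_forms N d P)"
proof (cases P rule: piece_set.cases)
  case (1 \<sigma> \<rho> a b)
  have "{(w, i, e). w \<in> weights a b \<and> e \<le> N div 2 \<and> i + degree w + 2 * e \<le> d}
      \<subseteq> weights a b \<times> {..d} \<times> {..d}" by auto
  moreover have "finite (weights a b)" by (simp add: weights_def)
  ultimately show ?thesis unfolding 1 piece_forms.simps
    by (intro finite_imageI) (rule finite_subset, assumption, simp)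
qed

lemma piece_forms_bound: "(e, f) \<in> piece_forms N d P \<Longrightarrow> e \<le> N div 2 + 1"
  by (cases P rule: piece_set.cases) auto

lemma piece_forms_sym: "(e, f) \<in> piece_forms N d P \<Longrightarrow> f p q = f q p"
  by (cases P rule: piece_set.cases) (auto simp: add.assoc add.commute[of q p])

lemma piece_cone_iff_forms:
  "y \<in> piece_cone N d P \<longleftrightarrow>
     (\<forall>(e, f)\<in>piece_forms N d P. \<forall>v. 0 \<le> (\<Sum>p<e. \<Sum>q<e. v p * v q * f p q y))"
  by (cases P rule: piece_set.cases)
    (simp add: moment_cone_def lessThan_Suc_atMost; blast)

lemma piece_cone_cong:
  assumes "y \<in> piece_cone N d P" "\<And>i. i \<le> d \<Longrightarrow> z i = y i"
  shows "z \<in> piece_cone N d P"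
  \<comment> \<open>The constant sequence \<open>y\<close> tends to \<open>z\<close> in all entries
    up to \<open>d\<close>, which is all that is asked for.\<close>
  by (rule piece_cone_closed[of "\<lambda>_. y"]) (use assms in simp_all)

lemma affine_linear_piece_forms:
  assumes "(e, f) \<in> piece_forms N d P" "\<And>i. i \<le> d \<Longrightarrow> affine_linear n (\<lambda>(x :: real ^ 'n) y. Y y i)"
  shows "affine_linear n (\<lambda>(x :: real ^ 'n) y. f p q (Y y))"
proof -
  have flip: "affine_linear n (\<lambda>(x :: real ^ 'n) y. Y y (flip_index \<rho> d i))" if "i \<in> {..d}" for \<rho> i
    by (rule assms(2)) (use that in \<open>simp add: flip_index_le\<close>)
  have *: "affine_linear n (\<lambda>(x :: real ^ 'n) y. riesz d (\<lambda>k. c k * Y y (flip_index \<rho> d k)) r)" for \<rho> c r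
    unfolding riesz_def by (intro affine_linear_sum affine_linear_scale flip)
  show ?thesis
  proof (cases P rule: piece_set.cases)
    case (1 \<sigma> \<rho> a b)
    then obtain w i where
      "f = (\<lambda>p q y. riesz d (\<lambda>k. \<sigma> ^ flip_index \<rho> d k * y (flip_index \<rho> d k)) (monom 1 (i + p + q) * w))"
      using assms(1) by auto
    then show ?thesis by (simp only: *)
  qed
qed

lemma affine_linear_coord: "affine_linear n (\<lambda>x y. coord m x e)"
  by (cases "e = 0") (auto simp: coord_def intro: affine_linear_const affine_linear_point)

text \<open>Equations become pairs of inequalities of size one, and the moment conditions become the
  Hankel forms; the rows of \<open>y\<close> up to index \<open>d\<close> are laid out one after
  another in a single lifting vector.\<close>

lemma has_lifted_sdr_lifts:
  fixes m :: "'n::finite \<Rightarrow> nat"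
  assumes D: "finite D" "D \<subseteq> {..d}"
  shows "has_lifted_sdr (N div 2 + 1) {x. \<exists>y. lifts m D N d ps x y}"
proof -
  define n where "n = length ps * Suc d"
  define Y :: "real Matrix.vec \<Rightarrow> nat \<Rightarrow> nat \<Rightarrow> real"
    where "Y = (\<lambda>y j i. vec_index y (j * Suc d + i))"
  define eq :: "(real ^ 'n \<Rightarrow> real Matrix.vec \<Rightarrow> real) \<Rightarrow> (real ^ 'n \<Rightarrow> real Matrix.vec \<Rightarrow> real) \<Rightarrow>
      (nat \<times> (nat \<Rightarrow> nat \<Rightarrow> real ^ 'n \<Rightarrow> real Matrix.vec \<Rightarrow> real)) set"
    where "eq = (\<lambda>f g. {(1, \<lambda>_ _ x y. f x y - g x y), (1, \<lambda>_ _ x y. g x y - f x y)})"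
  define sat :: "real ^ 'n \<Rightarrow> real Matrix.vec \<Rightarrow>
      (nat \<times> (nat \<Rightarrow> nat \<Rightarrow> real ^ 'n \<Rightarrow> real Matrix.vec \<Rightarrow> real)) set \<Rightarrow> bool"
    where "sat = (\<lambda>x y Q. \<forall>(e, A)\<in>Q. \<forall>v. 0 \<le> (\<Sum>i<e. \<Sum>j<e. v i * v j * A i j x y))"
  define Q1 where "Q1 = (\<Union>i. eq (\<lambda>x y. Finite_Cartesian_Product.vec_nth x i) (\<lambda>x y. coord m x (m i)))"
  define Q2 where "Q2 = (\<Union>e\<in>D. eq (\<lambda>x y. \<Sum>j<length ps. Y y j e) (\<lambda>x y. coord m x e))"
  define Q3 :: "(nat \<times> (nat \<Rightarrow> nat \<Rightarrow> real ^ 'n \<Rightarrow> real Matrix.vec \<Rightarrow> real)) set"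
    where "Q3 = (\<Union>j<length ps. (\<lambda>(e, f). (e, \<lambda>p q x y. f p q (Y y j))) ` piece_forms N d (ps ! j))"
  have sat_eq: "sat x y (eq f g) \<longleftrightarrow> f x y = g x y" for x y f g
    unfolding sat_def eq_def by (auto simp only: ball_simps split_conv quadratic_form_1)
  have sat_Union: "sat x y (\<Union>i\<in>J. R i) \<longleftrightarrow> (\<forall>i\<in>J. sat x y (R i))" for x y J and R :: "'k \<Rightarrow> _"
    unfolding sat_def by blast
  have sat_Un: "sat x y (R \<union> R') \<longleftrightarrow> sat x y R \<and> sat x y R'" for x y R R'
    unfolding sat_def by blast
  have sat_forms: "sat x y ((\<lambda>(e, f). (e, \<lambda>p q x y. f p q (Y y j))) ` piece_forms N d P)
      \<longleftrightarrow> Y y j \<in> piece_cone N d P" for x y j P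
    unfolding sat_def piece_cone_iff_forms by (simp add: case_prod_unfold)
  have sat_iff: "sat x y (Q1 \<union> Q2 \<union> Q3) \<longleftrightarrow> lifts m D N d ps x (Y y)" for x y
    unfolding sat_Un Q1_def Q2_def Q3_def sat_Union sat_eq sat_forms lifts_def by auto
  have affine_Y: "affine_linear n (\<lambda>x y. Y y j i)" if "j < length ps" "i \<le> d" for i j
  proof -
    have "j * Suc d + i < Suc j * Suc d" using that by simp
    also have "\<dots> \<le> n" unfolding n_def using that by (intro mult_le_mono1) auto
    finally show ?thesis unfolding Y_def by (rule affine_linear_lift)
  qed
  have aff_eq: "e \<le> N div 2 + 1 \<and> (\<forall>i<e. \<forall>j<e. affine_linear n (A i j)) \<and> (\<forall>i j. A i j = A j i)"
    if "(e, A) \<in> eq f g" "affine_linear n f" "affine_linear n g" for e A f g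
    using that by (auto simp: eq_def intro: affine_linear_diff)
  show ?thesis
  proof (rule has_lifted_sdrI[of "Q1 \<union> Q2 \<union> Q3"])
    show "finite (Q1 \<union> Q2 \<union> Q3)"
      unfolding Q1_def Q2_def Q3_def eq_def using D(1) by (auto intro: finite_piece_forms)
    show "e \<le> N div 2 + 1 \<and> (\<forall>i<e. \<forall>j<e. affine_linear n (A i j)) \<and> (\<forall>i j. A i j = A j i)"
      if QA: "(e, A) \<in> Q1 \<union> Q2 \<union> Q3" for e A
    proof -
      consider i where "(e, A) \<in> eq (\<lambda>x y. Finite_Cartesian_Product.vec_nth x i) (\<lambda>x y. coord m x (m i))"
        | e' where "e' \<in> D" "(e, A) \<in> eq (\<lambda>x y. \<Sum>j<length ps. Y y j e') (\<lambda>x y. coord m x e')"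
        | j f where "j < length ps" "(e, f) \<in> piece_forms N d (ps ! j)" "A = (\<lambda>p q x y. f p q (Y y j))"
        using QA unfolding Q1_def Q2_def Q3_def
        by (elim UnE UN_E imageE) (auto split: prod.splits)
      then show ?thesis
      proof cases
        case 1
        then show ?thesis by (rule aff_eq) (intro affine_linear_point affine_linear_coord)+
      next
        case 2
        show ?thesis using 2(2)
          by (rule aff_eq) (use 2(1) D(2) in \<open>auto intro!: affine_linear_sum affine_linear_coord affine_Y\<close>)
      next
        case 3
        then show ?thesis using piece_forms_bound[OF 3(2)] piece_forms_sym[OF 3(2)]
          by (auto intro!: affine_linear_piece_forms[OF 3(2)] affine_Y)
      qed
    qed
    fix x :: "real ^ 'n"
    have "\<exists>v\<in>carrier_vec n. lifts m D N d ps x (Y v)" if y: "lifts m D N d ps x y" for y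
    proof
      \<comment> \<open>Quotient and remainder by \<open>Suc d\<close> undo the layout; entries
        beyond \<open>d\<close> are not preserved, which \<open>piece_cone_cong\<close>
        tolerates.\<close>
      define v where "v = Matrix.vec n (\<lambda>k. y (k div Suc d) (k mod Suc d))"
      show "v \<in> carrier_vec n" by (simp add: v_def)
      have Yv: "Y v j i = y j i" if "j < length ps" "i \<le> d" for i j
      proof -
        have "j * Suc d + i < Suc j * Suc d" using that by simp
        also have "\<dots> \<le> n" unfolding n_def using that by (intro mult_le_mono1) auto
        finally have "Y v j i = y ((j * Suc d + i) div Suc d) ((j * Suc d + i) mod Suc d)"
          by (simp add: Y_def v_def)
        also have "(j * Suc d + i) div Suc d = j"
          using that by (subst div_mult_self3) auto
        also have "(j * Suc d + i) mod Suc d = i"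
          using that by (subst mod_mult_self3) auto
        finally show ?thesis .
      qed
      show "lifts m D N d ps x (Y v)"
        using y D(2) unfolding lifts_def by (auto simp: Yv subset_eq intro: piece_cone_cong)
    qed
    then show "x \<in> {x. \<exists>y. lifts m D N d ps x y} \<longleftrightarrow> (\<exists>y\<in>carrier_vec n. \<forall>(e, A)\<in>Q1 \<union> Q2 \<union> Q3.
        \<forall>v. 0 \<le> (\<Sum>i<e. \<Sum>j<e. v i * v j * A i j x y))"
      using sat_iff unfolding sat_def by blast
  qed
qed

subsection \<open>The closed convex hull\<close>

lemma simultaneous_convergent_subseq:
  fixes f :: "nat \<Rightarrow> 'j \<Rightarrow> real"
  assumes "finite J" "\<And>j. j \<in> J \<Longrightarrow> bounded (range (\<lambda>n. f n j))"
  shows "\<exists>r. strict_mono (r :: nat \<Rightarrow> nat) \<and> (\<forall>j\<in>J. convergent (\<lambda>n. f (r n) j))"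
  using assms
proof (induction J)
  case empty
  then show ?case by (intro exI[of _ id]) (auto simp: strict_mono_def)
next
  case (insert j J)
  then obtain r where r: "strict_mono (r :: nat \<Rightarrow> nat)" "\<And>j. j \<in> J \<Longrightarrow> convergent (\<lambda>n. f (r n) j)" by auto
  have "bounded (range (\<lambda>n. f (r n) j))"
    using insert.prems[of j] by (rule bounded_subset) auto
  then obtain l s where s: "strict_mono (s :: nat \<Rightarrow> nat)" "((\<lambda>n. f (r n) j) \<circ> s) \<longlonglongrightarrow> l"
    using bounded_imp_convergent_subsequence by blast
  show ?case
  proof (intro exI[of _ "r \<circ> s"] conjI ballI)
    show "strict_mono (r \<circ> s)" using r s by (intro strict_mono_o)
    fix k assume k: "k \<in> insert j J"
    show "convergent (\<lambda>n. f ((r \<circ> s) n) k)"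
    proof (cases "k = j")
      case True
      then show ?thesis using s(2) by (auto simp: o_def convergent_def)
    next
      case False
      then obtain l' where "(\<lambda>n. f (r n) k) \<longlonglongrightarrow> l'"
        using k r(2)[of k] by (auto simp: convergent_def)
      from LIMSEQ_subseq_LIMSEQ[OF this s(1)] show ?thesis by (auto simp: o_def convergent_def)
    qed
  qed
qed

lemma coord_lincomb:
  "u + v = 1 \<Longrightarrow> coord m (u *\<^sub>R x + v *\<^sub>R x') e = u * coord m x e + v * coord m x' e"
  by (simp add: coord_def)

lemma tendsto_coord: "x \<longlonglongrightarrow> l \<Longrightarrow> (\<lambda>n. coord m (x n) e) \<longlonglongrightarrow> coord m l e"
  by (cases "e = 0") (auto simp: coord_def intro: tendsto_vec_nth)

lemma coord_powers:
  assumes "e \<in> insert 0 (range m)"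
  shows "coord m (\<chi> i. t ^ m i) e = t ^ e"
proof (cases "e = 0")
  case False
  then have "m (inv_into UNIV m e) = e" using assms by (intro f_inv_into_f) auto
  then show ?thesis using False by (simp add: coord_def)
qed (simp add: coord_def)

lemma abs_power_le: "i \<le> d \<Longrightarrow> \<bar>t ^ i\<bar> \<le> 1 + \<bar>t\<bar> ^ d" for t :: real
proof (cases "\<bar>t\<bar> \<le> 1")
  case True
  then have "\<bar>t\<bar> ^ i \<le> 1" by (intro power_le_one) auto
  then show ?thesis by (simp add: power_abs add_increasing2)
next
  case False
  assume "i \<le> d"
  then have "\<bar>t\<bar> ^ i \<le> \<bar>t\<bar> ^ d" using False by (intro power_increasing) auto
  then show ?thesis by (simp add: power_abs)
qed

text \<open>The bound on \<open>y\<close> by an affine function of \<open>x\<close> keeps the set of \<open>x\<close> convex and makes it closed.\<close>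

lemma hull_subset_lifts:
  fixes m :: "'n::finite \<Rightarrow> nat"
  assumes D: "D \<subseteq> insert 0 (range m)" "d \<in> D" "D \<subseteq> {..d}"
    and ps: "\<forall>P\<in>set ps. valid_piece P" "I \<subseteq> \<Union> (piece_set ` set ps)"
    and growth: "\<And>t. t \<in> I \<Longrightarrow> \<bar>t\<bar> ^ d \<le> C + s * t ^ d"
  shows "closure (convex hull ((\<lambda>t. (\<chi> i. t ^ m i) :: real ^ 'n) ` I)) \<subseteq> {x. \<exists>y. lifts m D N d ps x y}"
proof -
  \<comment> \<open>On the curve, every power up to \<open>d\<close> has absolute value at most
    \<open>1 + \<bar>t\<bar> ^ d\<close>, and \<open>growth\<close> bounds this by an affine
    function of \<open>x\<close>.\<close>
  define B where "B = (\<lambda>x :: real ^ 'n. 1 + C + s * coord m x d)"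
  define G where "G = {x. \<exists>y. lifts m D N d ps x y \<and> (\<forall>j<length ps. \<forall>i\<le>d. \<bar>y j i\<bar> \<le> B x)}"
  have "(\<chi> i. t ^ m i) \<in> G" if t: "t \<in> I" for t
  proof -
    obtain k where k: "k < length ps" "t \<in> piece_set (ps ! k)"
      using ps(2) t by (metis (no_types, lifting) UN_E in_set_conv_nth subsetD)
    define y where "y = (\<lambda>j i. if j = k then t ^ i else 0)"
    have "lifts m D N d ps (\<chi> i. t ^ m i) y"
      unfolding lifts_def
    proof (intro conjI allI ballI impI)
      show "Finite_Cartesian_Product.vec_nth (\<chi> i. t ^ m i) i = coord m (\<chi> i. t ^ m i) (m i)" for i
        by (simp add: coord_powers)
      show "(\<Sum>j<length ps. y j e) = coord m (\<chi> i. t ^ m i) e" if "e \<in> D" for e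
        using that D(1) k(1) by (subst coord_powers) (auto simp: y_def)
      show "y j \<in> piece_cone N d (ps ! j)" if "j < length ps" for j
      proof (cases "j = k")
        case True
        have "y k = (\<lambda>i. t ^ i)" by (simp add: y_def)
        then show ?thesis using True powers_in_piece_cone k ps(1) by (metis nth_mem)
      next
        case False
        then show ?thesis using zero_in_piece_cone by (simp add: y_def)
      qed
    qed
    moreover have "coord m (\<chi> i. t ^ m i) d = t ^ d" using D by (intro coord_powers) auto
    then have "\<bar>y j i\<bar> \<le> B (\<chi> i. t ^ m i)" if "i \<le> d" for j i
      using growth[OF t] abs_power_le[OF that, of t] by (auto simp: B_def y_def)
    ultimately show ?thesis unfolding G_def by blast
  qed
  moreover have "convex G"
    unfolding convex_def
  proof (intro ballI allI impI)
    fix x x' :: "real ^ 'n" and u v :: real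
    assume *: "x \<in> G" "x' \<in> G" "0 \<le> u" "0 \<le> v" "u + v = 1"
    then obtain y y' where y: "lifts m D N d ps x y" "\<And>j i. j < length ps \<Longrightarrow> i \<le> d \<Longrightarrow> \<bar>y j i\<bar> \<le> B x"
      and y': "lifts m D N d ps x' y'" "\<And>j i. j < length ps \<Longrightarrow> i \<le> d \<Longrightarrow> \<bar>y' j i\<bar> \<le> B x'"
      unfolding G_def by blast
    define z where "z = (\<lambda>j i. u * y j i + v * y' j i)"
    have "lifts m D N d ps (u *\<^sub>R x + v *\<^sub>R x') z"
      using y(1) y'(1) * unfolding lifts_def z_def
      by (auto simp: coord_lincomb sum.distrib simp flip: sum_distrib_left intro: piece_cone_lincomb)
    moreover have "\<bar>z j i\<bar> \<le> B (u *\<^sub>R x + v *\<^sub>R x')" if "j < length ps" "i \<le> d" for j i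
    proof -
      have "\<bar>z j i\<bar> \<le> u * \<bar>y j i\<bar> + v * \<bar>y' j i\<bar>"
        unfolding z_def using * by (metis abs_mult abs_of_nonneg abs_triangle_ineq)
      also have "\<dots> \<le> u * B x + v * B x'"
        using * y(2) y'(2) that by (intro add_mono mult_left_mono) auto
      also have "\<dots> = (u + v) * (1 + C) + s * (u * coord m x d + v * coord m x' d)"
        by (simp add: B_def algebra_simps)
      also have "\<dots> = B (u *\<^sub>R x + v *\<^sub>R x')"
        using * by (simp add: B_def coord_lincomb)
      finally show ?thesis .
    qed
    ultimately show "u *\<^sub>R x + v *\<^sub>R x' \<in> G" unfolding G_def by blast
  qed
  moreover have "closed G"
    unfolding closed_sequential_limits
  proof (intro allI impI, elim conjE)
    fix x and l :: "real ^ 'n" assume x: "\<forall>n. x n \<in> G" "x \<longlonglongrightarrow> l"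
    then have "\<forall>n. \<exists>y. lifts m D N d ps (x n) y \<and> (\<forall>j<length ps. \<forall>i\<le>d. \<bar>y j i\<bar> \<le> B (x n))"
      unfolding G_def by blast
    then obtain y where y: "\<And>n. lifts m D N d ps (x n) (y n)"
      "\<And>n j i. j < length ps \<Longrightarrow> i \<le> d \<Longrightarrow> \<bar>y n j i\<bar> \<le> B (x n)" by metis
    have Blim: "(\<lambda>n. B (x n)) \<longlonglongrightarrow> B l"
      unfolding B_def by (intro tendsto_intros tendsto_coord x)
    then obtain K where K: "\<And>n. \<bar>B (x n)\<bar> \<le> K"
      using convergent_imp_bounded[OF Blim] by (auto simp: bounded_iff)
    define J where "J = {..<length ps} \<times> {..d}"
    \<comment> \<open>A convergent sequence of points has bounded lifts, so the lifts converge along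
      a subsequence.\<close>
    have "\<exists>r. strict_mono (r :: nat \<Rightarrow> nat) \<and> (\<forall>k\<in>J. convergent (\<lambda>n. y (r n) (fst k) (snd k)))"
    proof (rule simultaneous_convergent_subseq)
      show "finite J" by (simp add: J_def)
      fix k assume "k \<in> J"
      then have "\<bar>y n (fst k) (snd k)\<bar> \<le> K" for n
        using y(2)[of "fst k" "snd k" n] K[of n] by (auto simp: J_def)
      then show "bounded (range (\<lambda>n. y n (fst k) (snd k)))"
        by (auto simp: bounded_iff)
    qed
    then obtain r where r: "strict_mono (r :: nat \<Rightarrow> nat)"
      "\<And>k. k \<in> J \<Longrightarrow> convergent (\<lambda>n. y (r n) (fst k) (snd k))" by blast
    define z where "z = (\<lambda>j i. lim (\<lambda>n. y (r n) j i))"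
    have lim: "(\<lambda>n. y (r n) j i) \<longlonglongrightarrow> z j i" if "j < length ps" "i \<le> d" for j i
      using r(2)[of "(j, i)"] that by (simp add: J_def z_def convergent_LIMSEQ_iff)
    have xr: "(\<lambda>n. x (r n)) \<longlonglongrightarrow> l" using LIMSEQ_subseq_LIMSEQ[OF x(2) r(1)] by (simp add: o_def)
    have "lifts m D N d ps l z"
      unfolding lifts_def
    proof (intro conjI allI ballI impI)
      fix i
      have "(\<lambda>n. Finite_Cartesian_Product.vec_nth (x (r n)) i) \<longlonglongrightarrow> Finite_Cartesian_Product.vec_nth l i"
        by (intro tendsto_vec_nth xr)
      moreover have "(\<lambda>n. Finite_Cartesian_Product.vec_nth (x (r n)) i) = (\<lambda>n. coord m (x (r n)) (m i))"
        using y(1) unfolding lifts_def by blast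
      ultimately show "Finite_Cartesian_Product.vec_nth l i = coord m l (m i)"
        using tendsto_coord[OF xr, of m "m i"] LIMSEQ_unique by metis
    next
      fix e assume e: "e \<in> D"
      then have "(\<lambda>n. \<Sum>j<length ps. y (r n) j e) \<longlonglongrightarrow> (\<Sum>j<length ps. z j e)"
        using D(3) by (intro tendsto_sum lim) auto
      moreover have "(\<lambda>n. \<Sum>j<length ps. y (r n) j e) = (\<lambda>n. coord m (x (r n)) e)"
        using y(1) e unfolding lifts_def by blast
      ultimately show "(\<Sum>j<length ps. z j e) = coord m l e"
        using tendsto_coord[OF xr, of m e] LIMSEQ_unique by metis
    next
      fix j assume j: "j < length ps"
      show "z j \<in> piece_cone N d (ps ! j)"
      proof (rule piece_cone_closed)
        show "y (r n) j \<in> piece_cone N d (ps ! j)" for n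
          using y(1) j unfolding lifts_def by blast
      qed (rule lim[OF j])
    qed
    moreover have "\<bar>z j i\<bar> \<le> B l" if "j < length ps" "i \<le> d" for j i
    proof (rule LIMSEQ_le)
      show "(\<lambda>n. \<bar>y (r n) j i\<bar>) \<longlonglongrightarrow> \<bar>z j i\<bar>" by (intro tendsto_intros lim that)
      show "(\<lambda>n. B (x (r n))) \<longlonglongrightarrow> B l" using LIMSEQ_subseq_LIMSEQ[OF Blim r(1)] by (simp add: o_def)
    qed (use y(2) that in auto)
    ultimately show "l \<in> G" unfolding G_def by blast
  qed
  ultimately have "closure (convex hull ((\<lambda>t. (\<chi> i. t ^ m i) :: real ^ 'n) ` I)) \<subseteq> G"
    by (intro closure_minimal hull_minimal) auto
  then show ?thesis unfolding G_def by blast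
qed

text \<open>A point outside the hull is cut off by a hyperplane. This gives a polynomial nonnegative
  on \<open>I\<close>, with exponents among \<open>0\<close> and the \<open>m i\<close>, on which
  the sum of the lifted functionals is negative, contrary to
  \<open>riesz_nonneg_of_piece_cone\<close>.\<close>

lemma lifts_subset_hull:
  fixes m :: "'n::finite \<Rightarrow> nat"
  assumes D: "D \<subseteq> insert 0 (range m)" "0 \<in> D" "D \<subseteq> {..d}" "card D \<le> N + 1"
    and supp: "\<And>p. {i. coeff p i \<noteq> 0} \<subseteq> insert 0 (range m) \<Longrightarrow> \<forall>t\<in>I. poly p t \<ge> 0 \<Longrightarrow>
      {i. coeff p i \<noteq> 0} \<subseteq> D"
    and ps: "\<forall>P\<in>set ps. valid_piece P \<and> piece_set P \<subseteq> closure I"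
    and y: "lifts m D N d ps x y"
  shows "x \<in> closure (convex hull ((\<lambda>t. (\<chi> i. t ^ m i) :: real ^ 'n) ` I))"
proof (rule ccontr)
  assume "x \<notin> closure (convex hull ((\<lambda>t. (\<chi> i. t ^ m i) :: real ^ 'n) ` I))"
  then obtain a b where ab: "inner a x < b"
    "\<forall>z\<in>closure (convex hull ((\<lambda>t. (\<chi> i. t ^ m i) :: real ^ 'n) ` I)). inner a z > b"
    using separating_hyperplane_closed_point[of "closure (convex hull ((\<lambda>t. (\<chi> i. t ^ m i) :: real ^ 'n) ` I))" x]
    by (auto simp: convex_closure)
  define E where "E = insert 0 (range m)"
  have E: "finite E" by (simp add: E_def)
  let ?a = "Finite_Cartesian_Product.vec_nth a"
  \<comment> \<open>On the curve, \<open>p\<close> takes the value of the separating affine function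
    \<open>inner a z - b\<close>.\<close>
  define p where "p = monom (- b) 0 + (\<Sum>i\<in>UNIV. monom (?a i) (m i))"
  have coeff_p: "coeff p e = (if e = 0 then - b else 0) + (\<Sum>i\<in>UNIV. if m i = e then ?a i else 0)" for e
    by (simp add: p_def coeff_sum)
  have "coeff p e = 0" if "e \<notin> E" for e
    using that by (auto simp: coeff_p E_def intro!: sum.neutral)
  then have suppE: "{i. coeff p i \<noteq> 0} \<subseteq> E" by blast
  have pos: "poly p t \<ge> 0" if "t \<in> I" for t
  proof -
    have "inner a (\<chi> i. t ^ m i) > b"
      using ab(2) that by (meson closure_subset hull_subset imageI subsetD)
    then show ?thesis by (simp add: p_def poly_sum poly_monom inner_vec_def)
  qed
  have suppD: "{i. coeff p i \<noteq> 0} \<subseteq> D" using supp suppE pos unfolding E_def by blast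
  have closure_pos: "poly p t \<ge> 0" if "t \<in> closure I" for t
  proof -
    have "closed {t. poly p t \<ge> 0}" by (intro closed_Collect_le continuous_intros)
    then have "closure I \<subseteq> {t. poly p t \<ge> 0}" using pos by (intro closure_minimal) auto
    then show ?thesis using that by blast
  qed
  have fin: "finite D" using D(3) finite_subset by blast
  have deg: "degree p \<le> d"
  proof (cases "p = 0")
    case False
    then have "degree p \<in> {i. coeff p i \<noteq> 0}" by simp
    then show ?thesis using suppD D(3) by blast
  qed simp
  have card: "card {i. coeff p i \<noteq> 0} \<le> N + 1"
    using card_mono[OF fin suppD] D(4) by simp
  have "0 \<le> (\<Sum>j<length ps. riesz d (y j) p)"
  proof (rule sum_nonneg)
    fix j assume "j \<in> {..<length ps}"
    then have "y j \<in> piece_cone N d (ps ! j)" "valid_piece (ps ! j)" "piece_set (ps ! j) \<subseteq> closure I"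
      using y ps unfolding lifts_def by auto
    then show "0 \<le> riesz d (y j) p"
      using closure_pos by (intro riesz_nonneg_of_piece_cone[OF _ _ deg card]) auto
  qed
  also have "\<dots> = (\<Sum>e\<le>d. coeff p e * (\<Sum>j<length ps. y j e))"
    unfolding riesz_def sum_distrib_left by (rule sum.swap)
  also have "\<dots> = (\<Sum>e\<in>D. coeff p e * (\<Sum>j<length ps. y j e))"
    using D(3) suppD by (intro sum.mono_neutral_right) auto
  also have "\<dots> = (\<Sum>e\<in>D. coeff p e * coord m x e)"
    using y unfolding lifts_def by (intro sum.cong) auto
  \<comment> \<open>Coefficients outside \<open>D\<close> vanish, so the exponents on which the
    lifts put no constraint contribute nothing.\<close>
  also have "\<dots> = (\<Sum>e\<in>E. coeff p e * coord m x e)"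
    using suppD D(1) E by (intro sum.mono_neutral_left) (auto simp: E_def)
  also have "\<dots> = (\<Sum>e\<in>E. if e = 0 then - b else 0)
      + (\<Sum>e\<in>E. \<Sum>i\<in>UNIV. if m i = e then ?a i * coord m x e else 0)"
    unfolding coeff_p sum.distrib[symmetric] distrib_right sum_distrib_right
    by (intro sum.cong arg_cong2[of _ _ _ _ "(+)"]) (auto simp: coord_def)
  also have "(\<Sum>e\<in>E. \<Sum>i\<in>UNIV. if m i = e then ?a i * coord m x e else 0)
      = (\<Sum>i\<in>UNIV. \<Sum>e\<in>E. if m i = e then ?a i * coord m x e else 0)"
    by (rule sum.swap)
  also have "\<dots> = (\<Sum>i\<in>UNIV. ?a i * coord m x (m i))"
    using E by (simp add: sum.delta E_def)
  also have "\<dots> = inner a x"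
    using y unfolding lifts_def inner_vec_def by simp
  also have "(\<Sum>e\<in>E. if e = 0 then - b else 0) = - b"
    using E by (simp add: E_def)
  finally show False using ab(1) by simp
qed

text \<open>The quotient of \<open>p\<close> by its leading power tends to the leading coefficient
  at both ends, whereas an odd power changes sign; at one end \<open>p\<close> would be negative at
  points of \<open>I\<close>.\<close>

lemma even_degree_of_nonneg:
  fixes p :: "real poly"
  assumes "\<forall>t\<in>I. poly p t \<ge> 0" "\<not> bdd_above I" "\<not> bdd_below I"
  shows "even (degree p)"
proof (rule ccontr)
  assume odd: "odd (degree p)"
  have lim: "((\<lambda>x. poly p x / x ^ degree p) \<longlongrightarrow> lead_coeff p) at_infinity"
    by (rule poly_divide_tendsto_aux)
  have "lead_coeff p \<noteq> 0" using odd by auto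
  then consider "lead_coeff p < 0" | "lead_coeff p > 0" by linarith
  then show False
  proof cases
    case 1
    have "\<forall>\<^sub>F x in at_top. poly p x / x ^ degree p < 0"
      using order_tendstoD(2)[OF tendsto_mono[OF at_top_le_at_infinity lim] 1] .
    then obtain R where R: "\<And>x. x \<ge> R \<Longrightarrow> poly p x / x ^ degree p < 0"
      by (auto simp: eventually_at_top_linorder)
    obtain t where t: "t \<in> I" "t > max R 0"
      using assms(2) by (meson bdd_aboveI not_le)
    then have "poly p t / t ^ degree p < 0" "t ^ degree p > 0" using R by auto
    then show False
      using assms(1) t(1) divide_nonneg_pos[of "poly p t" "t ^ degree p"] by (meson not_less)
  next
    case 2
    have "\<forall>\<^sub>F x in at_bot. poly p x / x ^ degree p > 0"
      using order_tendstoD(1)[OF tendsto_mono[OF at_bot_le_at_infinity lim] 2] .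
    then obtain R where R: "\<And>x. x \<le> R \<Longrightarrow> poly p x / x ^ degree p > 0"
      by (auto simp: eventually_at_bot_linorder)
    obtain t where t: "t \<in> I" "t < min R 0"
      using assms(3) by (meson bdd_belowI not_le)
    have "t ^ degree p < 0" using odd t(2) by (simp add: power_less_zero_eq)
    then have "poly p t / t ^ degree p \<le> 0"
      using assms(1) t(1) divide_nonneg_neg[of "poly p t" "t ^ degree p"] by blast
    moreover have "poly p t / t ^ degree p > 0"
      using t(2) by (intro R) simp
    ultimately show False by simp
  qed
qed

text \<open>If \<open>I\<close> is unbounded in both directions, nonnegative polynomials have even degree, so the
  exponents above the largest even one play no role and \<open>d\<close> may be taken to be even.\<close>

lemma effective_exponents:
  fixes E :: "nat set"
  assumes "finite E" "0 \<in> E"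
  obtains D C s where "D \<subseteq> E" "0 \<in> D"
    "\<And>p :: real poly. {i. coeff p i \<noteq> 0} \<subseteq> E \<Longrightarrow> \<forall>t\<in>I. poly p t \<ge> 0 \<Longrightarrow> {i. coeff p i \<noteq> 0} \<subseteq> D"
    "\<And>t :: real. t \<in> I \<Longrightarrow> \<bar>t\<bar> ^ Max D \<le> C + s * t ^ Max D"
proof -
  consider "bdd_below I" | "bdd_above I" | "\<not> bdd_above I" "\<not> bdd_below I" by argo
  then show thesis
  proof cases
    case 1
    then obtain R0 where R0: "\<And>t. t \<in> I \<Longrightarrow> R0 \<le> t" by (auto simp: bdd_below_def)
    define R where "R = \<bar>R0\<bar>"
    \<comment> \<open>Negative points of \<open>I\<close> have absolute value at most
      \<open>R\<close>, so adding \<open>2 * R ^ Max E\<close> makes up for the sign of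
      \<open>t ^ Max E\<close>.\<close>
    show thesis
    proof (rule that[of E "2 * R ^ Max E" 1])
      fix t assume "t \<in> I"
      show "\<bar>t\<bar> ^ Max E \<le> 2 * R ^ Max E + 1 * t ^ Max E"
      proof (cases "t \<ge> 0")
        case False
        then have "\<bar>t\<bar> ^ Max E \<le> R ^ Max E"
          using R0[OF \<open>t \<in> I\<close>] by (intro power_mono) (auto simp: R_def)
        moreover have "- (\<bar>t\<bar> ^ Max E) \<le> t ^ Max E" by (simp flip: power_abs)
        ultimately show ?thesis by linarith
      qed (simp add: R_def)
    qed (use assms in auto)
  next
    case 2
    then obtain R0 where R0: "\<And>t. t \<in> I \<Longrightarrow> t \<le> R0" by (auto simp: bdd_above_def)
    define R where "R = \<bar>R0\<bar>"
    \<comment> \<open>The mirror image: \<open>(- 1) ^ Max E\<close> turns \<open>t\<close> into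
      \<open>- t\<close>.\<close>
    show thesis
    proof (rule that[of E "2 * R ^ Max E" "(- 1) ^ Max E"])
      fix t assume "t \<in> I"
      have eq: "(- 1) ^ Max E * t ^ Max E = (- t) ^ Max E" by (simp flip: power_mult_distrib)
      show "\<bar>t\<bar> ^ Max E \<le> 2 * R ^ Max E + (- 1) ^ Max E * t ^ Max E"
      proof (cases "t \<le> 0")
        case False
        then have "\<bar>t\<bar> ^ Max E \<le> R ^ Max E"
          using R0[OF \<open>t \<in> I\<close>] by (intro power_mono) (auto simp: R_def)
        moreover have "- (\<bar>- t\<bar> ^ Max E) \<le> (- t) ^ Max E" by (simp only: flip: power_abs)
        ultimately show ?thesis unfolding eq by simp
      qed (simp add: eq R_def)
    qed (use assms in auto)
  next
    case 3
    define k where "k = Max {e \<in> E. even e}"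
    have "k \<in> {e \<in> E. even e}" unfolding k_def using assms by (intro Max_in) auto
    then have k: "k \<in> E" "even k" by auto
    have kmax: "e \<le> k" if "e \<in> E" "even e" for e
      unfolding k_def using assms that by (intro Max_ge) auto
    have Max: "Max {e \<in> E. e \<le> k} = k" using assms k by (intro Max_eqI) auto
    show thesis
    proof (rule that[of "{e \<in> E. e \<le> k}" 0 1])
      fix p :: "real poly" assume p: "{i. coeff p i \<noteq> 0} \<subseteq> E" "\<forall>t\<in>I. poly p t \<ge> 0"
      show "{i. coeff p i \<noteq> 0} \<subseteq> {e \<in> E. e \<le> k}"
      proof (cases "p = 0")
        case False
        then have "degree p \<in> E" using p(1) by auto
        then have "degree p \<le> k" using kmax even_degree_of_nonneg[OF p(2) 3] by blast
        then show ?thesis using p(1) le_degree le_trans by blast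
      qed simp
    next
      show "\<bar>t\<bar> ^ Max {e \<in> E. e \<le> k} \<le> 0 + 1 * t ^ Max {e \<in> E. e \<le> k}" for t :: real
        unfolding Max using k(2) by (simp add: power_even_abs)
    qed (use assms in auto)
  qed
qed

theorem theorem3p19:
  fixes m :: "'n::finite \<Rightarrow> nat" and I :: "real set"
  assumes "\<And>i. 1 \<le> m i" and "semialgebraic I"
  shows "sxdeg (closure (convex hull ((\<lambda>t. (\<chi> i. t ^ m i) :: real ^ 'n) ` I)))
           \<le> enat (CARD('n) div 2 + 1)"
proof -
  let ?K = "closure (convex hull ((\<lambda>t. (\<chi> i. t ^ m i) :: real ^ 'n) ` I))"
  \<comment> \<open>Exponents of the affine functions on the curve, with \<open>0\<close> for the
    constant term.\<close>
  define E where "E = insert 0 (range m)"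
  have E: "finite E" "0 \<in> E" by (auto simp: E_def)
  obtain D C s where D: "D \<subseteq> E" "0 \<in> D"
    and supp: "\<And>p :: real poly. {i. coeff p i \<noteq> 0} \<subseteq> E \<Longrightarrow> \<forall>t\<in>I. poly p t \<ge> 0 \<Longrightarrow> {i. coeff p i \<noteq> 0} \<subseteq> D"
    and growth: "\<And>t :: real. t \<in> I \<Longrightarrow> \<bar>t\<bar> ^ Max D \<le> C + s * t ^ Max D"
    using effective_exponents[OF E, of I] by metis
  have finD: "finite D" using D(1) E(1) finite_subset by blast
  have maxD: "Max D \<in> D" "D \<subseteq> {..Max D}" using finD D(2) by (auto intro: Max_in)
  \<comment> \<open>At most one exponent per coordinate, plus the exponent \<open>0\<close>.\<close>
  have "card D \<le> card E" using D E by (intro card_mono)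
  also have "\<dots> \<le> Suc (card (range m))" unfolding E_def by (rule card_insert_le_m1) auto
  also have "\<dots> \<le> CARD('n) + 1" using card_image_le[of UNIV m] by simp
  finally have card: "card D \<le> CARD('n) + 1" .
  obtain PS where PS: "finite PS" "\<forall>P\<in>PS. valid_piece P \<and> piece_set P \<subseteq> closure I"
    "I \<subseteq> \<Union> (piece_set ` PS)"
    using semialgebraic_pieces[OF assms(2)] by blast
  obtain ps where ps: "set ps = PS" using finite_list[OF PS(1)] by blast
  have "?K = {x. \<exists>y. lifts m D (CARD('n)) (Max D) ps x y}"
  proof (intro equalityI)
    show "?K \<subseteq> {x. \<exists>y. lifts m D (CARD('n)) (Max D) ps x y}"
      by (rule hull_subset_lifts[OF D(1)[unfolded E_def] maxD _ _ growth]) (use PS ps in auto)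
    show "{x. \<exists>y. lifts m D (CARD('n)) (Max D) ps x y} \<subseteq> ?K"
    proof clarify
      fix x y assume "lifts m D (CARD('n)) (Max D) ps x y"
      then show "x \<in> ?K"
        using D maxD card supp PS(2) unfolding ps[symmetric] E_def
        by (intro lifts_subset_hull[of D m "Max D" "CARD('n)" I ps x y]) auto
    qed
  qed
  then have "has_lifted_sdr (CARD('n) div 2 + 1) ?K"
    using has_lifted_sdr_lifts[OF finD maxD(2), of "CARD('n)" m ps] by simp
  then show ?thesis unfolding sxdeg_def by (intro Inf_lower) blast
qed

end
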